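(* Let $(A,F^\bullet A,W_\bullet A,d_A,\ast)$ be a weight filtered differential filtered algebra. Then $(\operatorname{gr}^{[*]}\operatorname{gr}_*(A),d,\ast)$ and $(\operatorname{gr}_*\operatorname{gr}^{[*]}(A),d,\ast)$ are isomorphic weight graded dg algebras.
   Context: A differential filtered vector space $(V,F^\bullet V,d_V)$ is a vector space $V$ with an increasing filtration by subspaces $\cdots\subseteq F^iV\subseteq F^{i+1}V\subseteq\cdots$ ($i\in\mathbb Z$) with $\bigcap_iF^iV=0$, $\bigcup_iF^iV=V$, and a linear map $d_V:V\to V$ with $d_VF^iV\subseteq F^{i+1}V$ and $d_V^2F^iV\subseteq F^{i+1}V$. For $0\ne v\in V$ put $|v|=\min\{i\mid v\in F^iV\}$. The associated graded space $\operatorname{gr}^{[*]}(V)=\bigoplus_iF^iV/F^{i-1}V$ is a cochain complex with differential induced by $d_V$. A differential filtered algebra $(A,F^\bullet A,d_A,\ast)$ is a differential filtered vector space with an associative multiplication $\ast$ such that $F^iA\ast F^jA\subseteq F^{i+j}A$ and $d_A(a\ast b)-(d_Aa\ast b+(-1)^{|a|}a\ast d_Ab)\in F^{|a|+|b|}A$. Then $\operatorname{gr}^{[*]}(A)$ is a dg algebra. A weight filtered differential filtered algebra $(A,F^\bullet A,W_\bullet A,d_A,\ast)$ is a differential filtered algebra together with an increasing filtration by subspaces $\cdots\subseteq W_nA\subseteq W_{n+1}A\subseteq\cdots$ such that $d_A(W_nA)\subseteq W_nA$, $W_nA\ast W_mA\subseteq W_{n+m}A$, and $F^i(W_nA)=W_nA\cap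 F^iA$ makes $W_nA$ a differential filtered vector space. Iterated associated graded objects. $\operatorname{gr}_*(A)=\bigoplus_n\operatorname{gr}_n(A)$ with $\operatorname{gr}_n(A)=W_nA/W_{n-1}A$; it is filtered by letting $F^i\operatorname{gr}_n(A)$ be the image of $F^iA\cap W_nA$, and $\operatorname{gr}^{[*]}\operatorname{gr}_*(A)=\bigoplus_{i,n}F^i\operatorname{gr}_n(A)/F^{i-1}\operatorname{gr}_n(A)$. On the other hand, $\operatorname{gr}^{[i]}(A)=F^iA/F^{i-1}A$ is filtered by letting $W_n\operatorname{gr}^{[i]}(A)$ be the image of $F^iA\cap W_nA$, and $\operatorname{gr}_*\operatorname{gr}^{[*]}(A)=\bigoplus_{i,n}W_n\operatorname{gr}^{[i]}(A)/W_{n-1}\operatorname{gr}^{[i]}(A)$. Both carry the differential $d$ (of cohomological degree $+1$ and weight $0$) and the multiplication $\ast$ induced from $A$. A weight graded dg algebra is a dg algebra with an additional grading by subcomplexes (weight) that is additive under multiplication; an isomorphism respects both gradings, the differential and the multiplication. *)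

theory Defs
  imports "HOL-Algebra.Module" "HOL-Algebra.QuotRing"
begin

(* Algebras here are associative but not assumed unital: the record field "one" is never used. *)

record ('k, 'a) dmodule = "('k, 'a) module" +
  differential :: "'a \<Rightarrow> 'a"  (\<open>\<partial>\<index>\<close>)

definition linear_map ::
  "('k, 'r) ring_scheme \<Rightarrow> ('k, 'a, 'm) module_scheme \<Rightarrow> ('k, 'b, 'n) module_scheme
     \<Rightarrow> ('a \<Rightarrow> 'b) \<Rightarrow> bool" where
  "linear_map R M N f \<longleftrightarrow>
     f \<in> carrier M \<rightarrow> carrier N \<and>
     (\<forall>x\<in>carrier M. \<forall>y\<in>carrier M. f (x \<oplus>\<^bsub>M\<^esub> y) = f x \<oplus>\<^bsub>N\<^esub> f y) \<and>
     (\<forall>c\<in>carrier R. \<forall>x\<in>carrier M. f (c \<odot>\<^bsub>M\<^esub> x) = c \<odot>\<^bsub>N\<^esub> f x)"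

definition koszul :: "('a, 'm) ring_scheme \<Rightarrow> int \<Rightarrow> 'a \<Rightarrow> 'a" where
  "koszul M p x = (if even p then x else \<ominus>\<^bsub>M\<^esub> x)"

locale assoc_algebra = field R + module R A
  for R :: "('k, 'r) ring_scheme" (structure) and A :: "('k, 'a, 'm) module_scheme" (structure) +
  assumes mult_closed: "\<lbrakk>x \<in> carrier A; y \<in> carrier A\<rbrakk> \<Longrightarrow> x \<otimes>\<^bsub>A\<^esub> y \<in> carrier A"
    and mult_assoc:
      "\<lbrakk>x \<in> carrier A; y \<in> carrier A; z \<in> carrier A\<rbrakk> \<Longrightarrow>
         (x \<otimes>\<^bsub>A\<^esub> y) \<otimes>\<^bsub>A\<^esub> z = x \<otimes>\<^bsub>A\<^esub> (y \<otimes>\<^bsub>A\<^esub> z)"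
    and mult_linear_left: "y \<in> carrier A \<Longrightarrow> linear_map R A A (\<lambda>x. x \<otimes>\<^bsub>A\<^esub> y)"
    and mult_linear_right: "x \<in> carrier A \<Longrightarrow> linear_map R A A (\<lambda>y. x \<otimes>\<^bsub>A\<^esub> y)"


section \<open>Filtered objects\<close>

locale differential_filtered_space = field R + module R V
  for R :: "('k, 'r) ring_scheme" (structure) and V :: "('k, 'a, 'm) dmodule_scheme" (structure) +
  fixes F :: "int \<Rightarrow> 'a set"
  assumes F_subspace: "submodule (F i) R V"
    and F_mono: "F i \<subseteq> F (i + 1)"
    and F_Inter: "(\<Inter>i. F i) = {\<zero>\<^bsub>V\<^esub>}"
    and F_Union: "(\<Union>i. F i) = carrier V"
    and d_linear: "linear_map R V V \<partial>\<^bsub>V\<^esub>"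
    and d_filtered: "x \<in> F i \<Longrightarrow> \<partial>\<^bsub>V\<^esub> x \<in> F (i + 1)"
    and d_square_filtered: "x \<in> F i \<Longrightarrow> \<partial>\<^bsub>V\<^esub> (\<partial>\<^bsub>V\<^esub> x) \<in> F (i + 1)"

text \<open>The filtration degree $|v|$; only meaningful for \<open>v \<noteq> 0\<close>.\<close>

definition fdeg :: "(int \<Rightarrow> 'a set) \<Rightarrow> 'a \<Rightarrow> int" where
  "fdeg F v = (LEAST i. v \<in> F i)"

locale differential_filtered_algebra =
  differential_filtered_space R A F + assoc_algebra R A
  for R :: "('k, 'r) ring_scheme" (structure) and A :: "('k, 'a, 'm) dmodule_scheme" (structure)
    and F :: "int \<Rightarrow> 'a set" +
  assumes F_mult: "\<lbrakk>x \<in> F i; y \<in> F j\<rbrakk> \<Longrightarrow> x \<otimes>\<^bsub>A\<^esub> y \<in> F (i + j)"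
    and Leibniz_filtered:
      "\<lbrakk>a \<in> carrier A; a \<noteq> \<zero>\<^bsub>A\<^esub>; b \<in> carrier A; b \<noteq> \<zero>\<^bsub>A\<^esub>\<rbrakk> \<Longrightarrow>
         \<partial>\<^bsub>A\<^esub> (a \<otimes>\<^bsub>A\<^esub> b) \<ominus>\<^bsub>A\<^esub> (\<partial>\<^bsub>A\<^esub> a \<otimes>\<^bsub>A\<^esub> b \<oplus>\<^bsub>A\<^esub> koszul A (fdeg F a) (a \<otimes>\<^bsub>A\<^esub> \<partial>\<^bsub>A\<^esub> b))
           \<in> F (fdeg F a + fdeg F b)"

locale weight_filtered_algebra =
  differential_filtered_algebra R A F
  for R :: "('k, 'r) ring_scheme" (structure) and A :: "('k, 'a, 'm) dmodule_scheme" (structure)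
    and F :: "int \<Rightarrow> 'a set" +
  fixes W :: "int \<Rightarrow> 'a set"
  assumes W_subspace: "submodule (W n) R A"
    and W_mono: "W n \<subseteq> W (n + 1)"
    and W_d: "x \<in> W n \<Longrightarrow> \<partial>\<^bsub>A\<^esub> x \<in> W n"
    and W_mult: "\<lbrakk>x \<in> W n; y \<in> W m\<rbrakk> \<Longrightarrow> x \<otimes>\<^bsub>A\<^esub> y \<in> W (n + m)"
    and W_filtered:
      "differential_filtered_space R (A\<lparr>carrier := W n\<rparr>) (\<lambda>i. W n \<inter> F i)"


section \<open>Weight graded dg algebras\<close>

definition internal_grading ::
  "('k, 'r) ring_scheme \<Rightarrow> ('k, 'a, 'm) module_scheme \<Rightarrow> (int \<Rightarrow> 'a set) \<Rightarrow> bool" where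
  "internal_grading R M G \<longleftrightarrow>
     (\<forall>i. submodule (G i) R M) \<and>
     (\<forall>x\<in>carrier M. \<exists>!f. (\<forall>i. f i \<in> G i) \<and> finite {i. f i \<noteq> \<zero>\<^bsub>M\<^esub>} \<and>
        x = (\<Oplus>\<^bsub>M\<^esub>i\<in>{i. f i \<noteq> \<zero>\<^bsub>M\<^esub>}. f i))"

record ('k, 'a) bigraded = "('k, 'a) dmodule" +
  degree_part :: "int \<Rightarrow> 'a set"
  weight_part :: "int \<Rightarrow> 'a set"

locale dg_algebra = assoc_algebra R B
  for R :: "('k, 'r) ring_scheme" (structure) and B :: "('k, 'a, 'm) bigraded_scheme" (structure) +
  assumes degree_grading: "internal_grading R B (degree_part B)"
    and degree_mult:
      "\<lbrakk>x \<in> degree_part B i; y \<in> degree_part B j\<rbrakk> \<Longrightarrow> x \<otimes>\<^bsub>B\<^esub> y \<in> degree_part B (i + j)"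
    and d_linear: "linear_map R B B \<partial>\<^bsub>B\<^esub>"
    and d_degree: "x \<in> degree_part B i \<Longrightarrow> \<partial>\<^bsub>B\<^esub> x \<in> degree_part B (i + 1)"
    and d_square: "x \<in> carrier B \<Longrightarrow> \<partial>\<^bsub>B\<^esub> (\<partial>\<^bsub>B\<^esub> x) = \<zero>\<^bsub>B\<^esub>"
    and Leibniz:
      "\<lbrakk>x \<in> degree_part B i; y \<in> carrier B\<rbrakk> \<Longrightarrow>
         \<partial>\<^bsub>B\<^esub> (x \<otimes>\<^bsub>B\<^esub> y) = \<partial>\<^bsub>B\<^esub> x \<otimes>\<^bsub>B\<^esub> y \<oplus>\<^bsub>B\<^esub> koszul B i (x \<otimes>\<^bsub>B\<^esub> \<partial>\<^bsub>B\<^esub> y)"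

text \<open>Each weight part is a subcomplex, that is, a subspace that is stable under the
  differential and graded by its intersections with the cohomological degree parts.\<close>

locale weight_graded_dg_algebra = dg_algebra R B
  for R :: "('k, 'r) ring_scheme" (structure) and B :: "('k, 'a, 'm) bigraded_scheme" (structure) +
  assumes weight_grading: "internal_grading R B (weight_part B)"
    and weight_graded:
      "internal_grading R (B\<lparr>carrier := weight_part B n\<rparr>) (\<lambda>i. weight_part B n \<inter> degree_part B i)"
    and weight_d: "x \<in> weight_part B n \<Longrightarrow> \<partial>\<^bsub>B\<^esub> x \<in> weight_part B n"
    and weight_mult:
      "\<lbrakk>x \<in> weight_part B n; y \<in> weight_part B m\<rbrakk> \<Longrightarrow> x \<otimes>\<^bsub>B\<^esub> y \<in> weight_part B (n + m)"

definition weight_graded_dg_iso ::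
  "('k, 'r) ring_scheme \<Rightarrow> ('k, 'a, 'm) bigraded_scheme \<Rightarrow> ('k, 'b, 'n) bigraded_scheme
     \<Rightarrow> ('a \<Rightarrow> 'b) \<Rightarrow> bool" where
  "weight_graded_dg_iso R B C \<phi> \<longleftrightarrow>
     bij_betw \<phi> (carrier B) (carrier C) \<and>
     linear_map R B C \<phi> \<and>
     (\<forall>i. \<phi> ` degree_part B i = degree_part C i) \<and>
     (\<forall>n. \<phi> ` weight_part B n = weight_part C n) \<and>
     (\<forall>x\<in>carrier B. \<phi> (\<partial>\<^bsub>B\<^esub> x) = \<partial>\<^bsub>C\<^esub> (\<phi> x)) \<and>
     (\<forall>x\<in>carrier B. \<forall>y\<in>carrier B. \<phi> (x \<otimes>\<^bsub>B\<^esub> y) = \<phi> x \<otimes>\<^bsub>C\<^esub> \<phi> y)"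


section \<open>Associated graded objects\<close>

text \<open>The quotient \<open>P n / P (n - 1)\<close>, consisting of cosets. As usual for cosets
  (cf. \<^const>\<open>set_mult\<close> and \<^const>\<open>rcoset_mult\<close>), an operation is induced from one on
  representatives by taking the union of the cosets of all results.

  The multiplication and the differential of \<open>gr_part M P n\<close> are those induced maps that
  \<^emph>\<open>take values\<close> in \<open>P n / P (n - 1)\<close>; their arguments in general come from other parts
  \<open>P i / P (i - 1)\<close>. Thus the product of classes in the parts \<open>i\<close> and \<open>j\<close> is
  the multiplication of the part \<open>i + j\<close>.\<close>

definition gr_part ::
  "('k, 'a, 'm) dmodule_scheme \<Rightarrow> (int \<Rightarrow> 'a set) \<Rightarrow> int \<Rightarrow> ('k, 'a set) dmodule" where
  "gr_part M P n =
     \<lparr>carrier = (\<lambda>x. P (n - 1) +>\<^bsub>M\<^esub> x) ` P n,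
      mult = (\<lambda>U V. \<Union>x\<in>U. \<Union>y\<in>V. P (n - 1) +>\<^bsub>M\<^esub> (x \<otimes>\<^bsub>M\<^esub> y)),
      one = undefined,
      zero = P (n - 1),
      add = (\<lambda>U V. U <+>\<^bsub>M\<^esub> V),
      smult = (\<lambda>c U. \<Union>x\<in>U. P (n - 1) +>\<^bsub>M\<^esub> (c \<odot>\<^bsub>M\<^esub> x)),
      differential = (\<lambda>U. \<Union>x\<in>U. P (n - 1) +>\<^bsub>M\<^esub> \<partial>\<^bsub>M\<^esub> x)\<rparr>"

text \<open>The filtration that a second filtration \<open>Q\<close> induces on \<open>gr_part M P n\<close>.\<close>

definition gr_filtration ::
  "('k, 'a, 'm) dmodule_scheme \<Rightarrow> (int \<Rightarrow> 'a set) \<Rightarrow> (int \<Rightarrow> 'a set) \<Rightarrow> int \<Rightarrow> int \<Rightarrow> 'a set set"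
  where "gr_filtration M P Q n i = (\<lambda>x. P (n - 1) +>\<^bsub>M\<^esub> x) ` (Q i \<inter> P n)"

text \<open>The direct sum of the spaces \<open>C i n\<close> of cohomological degree \<open>i\<close> and weight \<open>n\<close>, where
  (as for \<^const>\<open>gr_part\<close>) the multiplication and the differential of \<open>C i n\<close> take values
  in \<open>C i n\<close>, and the differential has degree 1 and weight 0.\<close>

definition bigraded_sum ::
  "(int \<Rightarrow> int \<Rightarrow> ('k, 'a, 'm) dmodule_scheme) \<Rightarrow> ('k, int \<Rightarrow> int \<Rightarrow> 'a) bigraded" where
  "bigraded_sum C =
    (let S = {f. (\<forall>i n. f i n \<in> carrier (C i n)) \<and> finite {(i, n). f i n \<noteq> \<zero>\<^bsub>C i n\<^esub>}} in
     \<lparr>carrier = S,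
      mult = (\<lambda>f g k l. \<Oplus>\<^bsub>C k l\<^esub>p\<in>{(i, n). f i n \<noteq> \<zero>\<^bsub>C i n\<^esub>}.
                f (fst p) (snd p) \<otimes>\<^bsub>C k l\<^esub> g (k - fst p) (l - snd p)),
      one = undefined,
      zero = (\<lambda>i n. \<zero>\<^bsub>C i n\<^esub>),
      add = (\<lambda>f g i n. f i n \<oplus>\<^bsub>C i n\<^esub> g i n),
      smult = (\<lambda>c f i n. c \<odot>\<^bsub>C i n\<^esub> f i n),
      differential = (\<lambda>f i n. \<partial>\<^bsub>C i n\<^esub> (f (i - 1) n)),
      degree_part = (\<lambda>i. {f \<in> S. \<forall>j n. j \<noteq> i \<longrightarrow> f j n = \<zero>\<^bsub>C j n\<^esub>}),
      weight_part = (\<lambda>n. {f \<in> S. \<forall>i m. m \<noteq> n \<longrightarrow> f i m = \<zero>\<^bsub>C i m\<^esub>})\<rparr>)"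

text \<open>With \<open>gr_n\<close> the parts for the weight filtration \<open>W\<close> and \<open>gr^[i]\<close> those for \<open>F\<close>:
  first the sum of the \<open>gr^[i] gr_n\<close>, then the sum of the \<open>gr_n gr^[i]\<close>.\<close>

definition gr_F_gr_W ::
  "('k, 'a, 'm) dmodule_scheme \<Rightarrow> (int \<Rightarrow> 'a set) \<Rightarrow> (int \<Rightarrow> 'a set)
     \<Rightarrow> ('k, int \<Rightarrow> int \<Rightarrow> 'a set set) bigraded" where
  "gr_F_gr_W A F W = bigraded_sum (\<lambda>i n. gr_part (gr_part A W n) (gr_filtration A W F n) i)"

definition gr_W_gr_F ::
  "('k, 'a, 'm) dmodule_scheme \<Rightarrow> (int \<Rightarrow> 'a set) \<Rightarrow> (int \<Rightarrow> 'a set)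
     \<Rightarrow> ('k, int \<Rightarrow> int \<Rightarrow> 'a set set) bigraded" where
  "gr_W_gr_F A F W = bigraded_sum (\<lambda>i n. gr_part (gr_part A F i) (gr_filtration A F W i) n)"

end

theory Submission
  imports Defs
begin

text \<open>
  The idea is Zassenhaus' butterfly lemma, carried out in every bidegree at once. An element of
  \<open>F\<^sup>i A \<inter> W\<^sub>n A\<close> has a class in \<open>gr\<^sup>i gr\<^sub>n A\<close> and a class in \<open>gr\<^sub>n gr\<^sup>i A\<close>, and all elements of these
  two spaces arise in this way. In both cases the class vanishes exactly on
  \<open>(F\<^sup>i\<^sup>-\<^sup>1 A \<inter> W\<^sub>n A) + (F\<^sup>i A \<inter> W\<^sub>n\<^sub>-\<^sub>1 A)\<close>, which is symmetric in the two filtrations. So both spaces are the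
  quotient of \<open>F\<^sup>i A \<inter> W\<^sub>n A\<close> by one and the same subspace. Both multiplications and both differentials are
  induced from \<open>A\<close> on representatives in \<open>F\<^sup>i A \<inter> W\<^sub>n A\<close>, hence they correspond under the resulting
  bijections.

  The quotient of a quotient occurs only in the locale \<open>two_filtrations\<close>. There two
  filtrations \<open>P\<close> and \<open>Q\<close> play interchangeable roles, apart from the amounts by which the differential
  shifts them, so that the results apply to \<open>(W, F)\<close> and to \<open>(F, W)\<close>; the description of
  the kernel is \<open>gr_gr_class_eq_iff\<close>. What these results say is then recorded in the locale
  \<open>bigraded_presentation\<close>: a family of surjections from the spaces \<open>F\<^sup>i A \<inter> W\<^sub>n A\<close> that is
  compatible with all operations and has the kernels above. Any two presentations have
  isomorphic targets (\<open>bigraded_presentation_unique\<close>).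

  That the targets form a weight graded dg algebra also follows from the presentation alone. All
  identities hold for representatives in \<open>A\<close>, except \<open>\<partial>\<^sup>2 = 0\<close> and the Leibniz rule, which hold
  there up to an element of filtration degree one lower, and such elements have class zero
  (\<open>targets_bigraded_dg_pieces\<close>). It remains to pass from identities between homogeneous elements to the
  direct sum with its convolution product and finite supports
  (\<open>bigraded_sum_weight_graded_dg_algebra\<close>, \<open>bigraded_sum_isoI\<close>).
\<close>

section \<open>Linear maps, submodules and internal gradings\<close>

lemma linear_mapD:
  assumes "linear_map R M N f"
  shows "x \<in> carrier M \<Longrightarrow> f x \<in> carrier N"
    and "\<lbrakk>x \<in> carrier M; y \<in> carrier M\<rbrakk> \<Longrightarrow> f (x \<oplus>\<^bsub>M\<^esub> y) = f x \<oplus>\<^bsub>N\<^esub> f y"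
    and "\<lbrakk>c \<in> carrier R; x \<in> carrier M\<rbrakk> \<Longrightarrow> f (c \<odot>\<^bsub>M\<^esub> x) = c \<odot>\<^bsub>N\<^esub> f x"
  using assms by (auto simp: linear_map_def)

lemma linear_map_abelian_group_hom:
  assumes "linear_map R M N f" "module R M" "module R N"
  shows "abelian_group_hom M N f"
proof -
  interpret M: module R M by fact
  interpret N: module R N by fact
  show ?thesis
    by (intro abelian_group_homI group_hom.intro group_hom_axioms.intro homI
        M.abelian_group_axioms N.abelian_group_axioms M.a_group N.a_group)
      (use assms(1) in \<open>auto simp: linear_map_def\<close>)
qed

lemma linear_map_zero:
  assumes "linear_map R M N f" "module R M" "module R N"
  shows "f \<zero>\<^bsub>M\<^esub> = \<zero>\<^bsub>N\<^esub>"
  using abelian_group_hom.hom_zero[OF linear_map_abelian_group_hom[OF assms]] .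

lemma linear_map_minus:
  assumes "linear_map R M N f" "module R M" "module R N" "x \<in> carrier M" "y \<in> carrier M"
  shows "f (x \<ominus>\<^bsub>M\<^esub> y) = f x \<ominus>\<^bsub>N\<^esub> f y"
proof -
  interpret f: abelian_group_hom M N f
    using linear_map_abelian_group_hom[OF assms(1-3)] .
  show ?thesis using assms(4,5) by (simp add: a_minus_def)
qed

lemma linear_map_finsum:
  assumes f: "linear_map R M N f" "module R M" "module R N"
    and g: "g \<in> I \<rightarrow> carrier M"
  shows "f (\<Oplus>\<^bsub>M\<^esub>i\<in>I. g i) = (\<Oplus>\<^bsub>N\<^esub>i\<in>I. f (g i))"
proof -
  interpret M: module R M by fact
  interpret N: module R N by fact
  note zero = linear_map_zero[OF f]
  show ?thesis
  proof (cases "finite I")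
    case False
    then show ?thesis by (simp add: zero)
  next
    case True
    then show ?thesis using g
    proof (induction I)
      case empty
      then show ?case by (simp add: zero)
    next
      case (insert i I)
      then have "g i \<in> carrier M" "g \<in> I \<rightarrow> carrier M" "(\<lambda>i. f (g i)) \<in> I \<rightarrow> carrier N"
        "f (g i) \<in> carrier N"
        using linear_mapD(1)[OF f(1)] by auto
      with insert show ?case
        by (simp add: linear_mapD(2)[OF f(1)])
    qed
  qed
qed

lemma (in module) koszul_linear: "linear_map R M M (koszul M p)"
  by (auto simp: linear_map_def koszul_def smult_r_minus M.minus_add)

lemma (in abelian_monoid) finsum_swap:
  assumes "finite I" "finite J" "\<And>i j. \<lbrakk>i \<in> I; j \<in> J\<rbrakk> \<Longrightarrow> f i j \<in> carrier G"
  shows "(\<Oplus>i\<in>I. \<Oplus>j\<in>J. f i j) = (\<Oplus>j\<in>J. \<Oplus>i\<in>I. f i j)"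
  using assms(1,3)
proof (induction I)
  case empty
  then show ?case by simp
next
  case (insert a I)
  have "(\<Oplus>i\<in>insert a I. \<Oplus>j\<in>J. f i j) = (\<Oplus>j\<in>J. f a j) \<oplus> (\<Oplus>i\<in>I. \<Oplus>j\<in>J. f i j)"
    using insert by (intro finsum_insert) (auto intro!: finsum_closed)
  also have "(\<Oplus>i\<in>I. \<Oplus>j\<in>J. f i j) = (\<Oplus>j\<in>J. \<Oplus>i\<in>I. f i j)"
    using insert by auto
  also have "(\<Oplus>j\<in>J. f a j) \<oplus> \<dots> = (\<Oplus>j\<in>J. f a j \<oplus> (\<Oplus>i\<in>I. f i j))"
    using insert by (intro finsum_addf[symmetric]) (auto intro!: finsum_closed)
  also have "\<dots> = (\<Oplus>j\<in>J. \<Oplus>i\<in>insert a I. f i j)"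
    using insert by (intro finsum_cong') (auto intro!: finsum_closed finsum_insert[symmetric])
  finally show ?case .
qed

lemma (in abelian_group) add_minus_cancel:
  assumes "x \<in> carrier G" "y \<in> carrier G"
  shows "(x \<oplus> y) \<ominus> x = y"
  using assms a_comm[of x y] by (simp add: a_minus_def a_assoc r_neg)

lemma (in abelian_group) add_minus_cancel':
  assumes "x \<in> carrier G" "y \<in> carrier G"
  shows "x \<oplus> (y \<ominus> x) = y"
  using assms a_comm[of y "\<ominus> x"] by (simp add: a_minus_def r_neg2)

lemma (in abelian_group) set_add_commute:
  assumes "H \<subseteq> carrier G" "K \<subseteq> carrier G"
  shows "H <+>\<^bsub>G\<^esub> K = K <+>\<^bsub>G\<^esub> H"
proof -
  have "S <+>\<^bsub>G\<^esub> T \<subseteq> T <+>\<^bsub>G\<^esub> S" if ST: "S \<subseteq> carrier G" "T \<subseteq> carrier G" for S T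
  proof
    fix x assume "x \<in> S <+>\<^bsub>G\<^esub> T"
    then obtain s t where st: "s \<in> S" "t \<in> T" and x: "x = s \<oplus> t" unfolding set_add_def' by blast
    have "x = t \<oplus> s" unfolding x by (rule a_comm[OF subsetD[OF ST(1) st(1)] subsetD[OF ST(2) st(2)]])
    with st show "x \<in> T <+>\<^bsub>G\<^esub> S" unfolding set_add_def' by blast
  qed
  with assms show ?thesis by (intro subset_antisym)
qed

text \<open>The module axioms are inherited by any surjective image of a submodule. This is how all
  quotients below become modules, without any computation with cosets beyond the
  compatibility of the class map with the operations.\<close>

lemma module_imageI:
  fixes M :: "('k, 'a, 'm) module_scheme" and N :: "('k, 'b, 'n) module_scheme"
  assumes M: "module R M" and H: "submodule H R M"
    and carrier: "carrier N = f ` H"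
    and zero: "\<zero>\<^bsub>N\<^esub> = f \<zero>\<^bsub>M\<^esub>"
    and add: "\<And>x y. \<lbrakk>x \<in> H; y \<in> H\<rbrakk> \<Longrightarrow> f x \<oplus>\<^bsub>N\<^esub> f y = f (x \<oplus>\<^bsub>M\<^esub> y)"
    and smult: "\<And>c x. \<lbrakk>c \<in> carrier R; x \<in> H\<rbrakk> \<Longrightarrow> c \<odot>\<^bsub>N\<^esub> f x = f (c \<odot>\<^bsub>M\<^esub> x)"
  shows "module R N"
proof -
  interpret M: module R M by (rule M)
  note sub = M.submoduleE(1)[OF H] and neg = M.submoduleE(3)[OF H]
    and sc = M.submoduleE(4)[OF H] and ac = M.submoduleE(5)[OF H]
  have c: "x \<in> carrier M" if "x \<in> H" for x using sub that by blast
  have z: "\<zero>\<^bsub>M\<^esub> \<in> H"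
    using subgroup.one_closed[OF submodule.axioms(1)[OF H]] by simp
  have "abelian_group N"
  proof (rule abelian_groupI)
    show "x \<oplus>\<^bsub>N\<^esub> y \<in> carrier N" if "x \<in> carrier N" "y \<in> carrier N" for x y
      using that ac unfolding carrier by (auto simp: add)
    show "\<zero>\<^bsub>N\<^esub> \<in> carrier N" using z by (simp add: carrier zero)
    show "x \<oplus>\<^bsub>N\<^esub> y \<oplus>\<^bsub>N\<^esub> z = x \<oplus>\<^bsub>N\<^esub> (y \<oplus>\<^bsub>N\<^esub> z)"
      if "x \<in> carrier N" "y \<in> carrier N" "z \<in> carrier N" for x y z
      using that unfolding carrier by (auto simp: add ac c M.a_assoc)
    show "x \<oplus>\<^bsub>N\<^esub> y = y \<oplus>\<^bsub>N\<^esub> x" if xy: "x \<in> carrier N" "y \<in> carrier N" for x y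
    proof -
      from xy obtain u v where uv: "u \<in> H" "v \<in> H" "x = f u" "y = f v" unfolding carrier by blast
      then show ?thesis using M.a_comm[OF c c, of u v] by (simp add: add)
    qed
    show "\<zero>\<^bsub>N\<^esub> \<oplus>\<^bsub>N\<^esub> x = x" if "x \<in> carrier N" for x
      using that z unfolding carrier zero by (auto simp: add c)
    show "\<exists>y\<in>carrier N. y \<oplus>\<^bsub>N\<^esub> x = \<zero>\<^bsub>N\<^esub>" if x: "x \<in> carrier N" for x
    proof -
      from x obtain u where u: "u \<in> H" "x = f u" unfolding carrier by blast
      then have "f (\<ominus>\<^bsub>M\<^esub> u) \<oplus>\<^bsub>N\<^esub> x = \<zero>\<^bsub>N\<^esub>"
        using neg[of u] by (simp add: add c M.l_neg zero)
      then show ?thesis using neg[of u] u(1) unfolding carrier by blast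
    qed
  qed
  then show ?thesis
  proof (rule moduleI[OF M.R.is_cring])
    show "c \<odot>\<^bsub>N\<^esub> x \<in> carrier N" if "c \<in> carrier R" "x \<in> carrier N" for c x
      using that sc unfolding carrier by (auto simp: smult)
    show "(a \<oplus>\<^bsub>R\<^esub> b) \<odot>\<^bsub>N\<^esub> x = a \<odot>\<^bsub>N\<^esub> x \<oplus>\<^bsub>N\<^esub> b \<odot>\<^bsub>N\<^esub> x"
      if "a \<in> carrier R" "b \<in> carrier R" "x \<in> carrier N" for a b x
      using that unfolding carrier by (auto simp: add smult sc c M.smult_l_distr)
    show "a \<odot>\<^bsub>N\<^esub> (x \<oplus>\<^bsub>N\<^esub> y) = a \<odot>\<^bsub>N\<^esub> x \<oplus>\<^bsub>N\<^esub> a \<odot>\<^bsub>N\<^esub> y"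
      if "a \<in> carrier R" "x \<in> carrier N" "y \<in> carrier N" for a x y
      using that unfolding carrier by (auto simp: add smult sc ac c M.smult_r_distr)
    show "(a \<otimes>\<^bsub>R\<^esub> b) \<odot>\<^bsub>N\<^esub> x = a \<odot>\<^bsub>N\<^esub> (b \<odot>\<^bsub>N\<^esub> x)"
      if "a \<in> carrier R" "b \<in> carrier R" "x \<in> carrier N" for a b x
      using that unfolding carrier by (auto simp: smult sc c M.smult_assoc1)
    show "\<one>\<^bsub>R\<^esub> \<odot>\<^bsub>N\<^esub> x = x" if "x \<in> carrier N" for x
      using that unfolding carrier by (auto simp: smult c)
  qed
qed

lemma (in module) submodule_Int:
  assumes "submodule H R M" "submodule K R M"
  shows "submodule (H \<inter> K) R M"
proof (rule submoduleI)
  show "\<zero>\<^bsub>M\<^esub> \<in> H \<inter> K"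
    using assms[THEN submodule.axioms(1), THEN subgroup.one_closed] by simp
qed (use submoduleE(1)[OF assms(1)] submoduleE(3-5)[OF assms(1)] submoduleE(3-5)[OF assms(2)]
  in \<open>simp_all add: le_infI1\<close>)

text \<open>A system of projections onto the parts is easier to provide than unique
  decompositions. Applying the projections to \<open>x = (\<Sum>i. f i)\<close> forces \<open>f i = pr i x\<close>; conversely
  the difference of \<open>x\<close> and the sum of its projections is killed by every projection.\<close>

lemma internal_gradingI:
  fixes pr :: "int \<Rightarrow> 'a \<Rightarrow> 'a"
  assumes M: "module R M"
    and sub: "\<And>i. submodule (G i) R M"
    and lin: "\<And>i. linear_map R M M (pr i)"
    and into: "\<And>i x. x \<in> carrier M \<Longrightarrow> pr i x \<in> G i"
    and same: "\<And>i x. x \<in> G i \<Longrightarrow> pr i x = x"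
    and other: "\<And>i j x. \<lbrakk>x \<in> G i; j \<noteq> i\<rbrakk> \<Longrightarrow> pr j x = \<zero>\<^bsub>M\<^esub>"
    and fin: "\<And>x. x \<in> carrier M \<Longrightarrow> finite {i. pr i x \<noteq> \<zero>\<^bsub>M\<^esub>}"
    and faithful: "\<And>x. \<lbrakk>x \<in> carrier M; \<And>i. pr i x = \<zero>\<^bsub>M\<^esub>\<rbrakk> \<Longrightarrow> x = \<zero>\<^bsub>M\<^esub>"
  shows "internal_grading R M G"
  unfolding internal_grading_def
proof (intro conjI allI ballI sub)
  interpret M: module R M by fact
  have G: "G i \<subseteq> carrier M" for i using M.submoduleE(1)[OF sub] .
  have pr_sum: "pr j (\<Oplus>\<^bsub>M\<^esub>i\<in>{i. f i \<noteq> \<zero>\<^bsub>M\<^esub>}. f i) = f j"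
    if f: "\<forall>i. f i \<in> G i" and "finite {i. f i \<noteq> \<zero>\<^bsub>M\<^esub>}" for f j
  proof -
    have fc: "f i \<in> carrier M" for i using f G by auto
    have "pr j (\<Oplus>\<^bsub>M\<^esub>i\<in>{i. f i \<noteq> \<zero>\<^bsub>M\<^esub>}. f i) = (\<Oplus>\<^bsub>M\<^esub>i\<in>{i. f i \<noteq> \<zero>\<^bsub>M\<^esub>}. pr j (f i))"
      using fc by (intro linear_map_finsum[OF lin M M]) auto
    also have "\<dots> = (\<Oplus>\<^bsub>M\<^esub>i\<in>insert j {i. f i \<noteq> \<zero>\<^bsub>M\<^esub>}. if j = i then f i else \<zero>\<^bsub>M\<^esub>)"
    proof (rule M.add.finprod_mono_neutral_cong_left)
      have "pr j (f i) = (if j = i then f i else \<zero>\<^bsub>M\<^esub>)" for i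
        using same[of "f j" j] other[of "f i" i j] f by auto
      then show "\<And>i. i \<in> {i. f i \<noteq> \<zero>\<^bsub>M\<^esub>} \<Longrightarrow> pr j (f i) = (if j = i then f i else \<zero>\<^bsub>M\<^esub>)" .
    qed (use that(2) fc in auto)
    also have "\<dots> = f j"
      using that fc by (intro M.finsum_singleton) auto
    finally show ?thesis .
  qed
  fix x assume x: "x \<in> carrier M"
  let ?S = "\<Oplus>\<^bsub>M\<^esub>i\<in>{i. pr i x \<noteq> \<zero>\<^bsub>M\<^esub>}. pr i x"
  show "\<exists>!f. (\<forall>i. f i \<in> G i) \<and> finite {i. f i \<noteq> \<zero>\<^bsub>M\<^esub>} \<and> x = (\<Oplus>\<^bsub>M\<^esub>i\<in>{i. f i \<noteq> \<zero>\<^bsub>M\<^esub>}. f i)"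
  proof (rule ex1I[of _ "\<lambda>i. pr i x"])
    have Sc: "?S \<in> carrier M" using into[OF x] G by (intro M.finsum_closed) auto
    have prS: "pr i ?S = pr i x" for i
      by (rule pr_sum) (use into[OF x] fin[OF x] in auto)
    have "x \<ominus>\<^bsub>M\<^esub> ?S = \<zero>\<^bsub>M\<^esub>"
    proof (rule faithful)
      show "x \<ominus>\<^bsub>M\<^esub> ?S \<in> carrier M" using x Sc by (rule M.minus_closed)
      show "pr i (x \<ominus>\<^bsub>M\<^esub> ?S) = \<zero>\<^bsub>M\<^esub>" for i
        unfolding linear_map_minus[OF lin M M x Sc] prS
        using linear_mapD(1)[OF lin x, of i] by (simp add: a_minus_def M.r_neg)
    qed
    then have "x = ?S"
      using x Sc M.minus_equality[of x "\<ominus>\<^bsub>M\<^esub> ?S"] by (simp add: a_minus_def)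
    then show "(\<forall>i. pr i x \<in> G i) \<and> finite {i. pr i x \<noteq> \<zero>\<^bsub>M\<^esub>} \<and> x = ?S"
      using into[OF x] fin[OF x] by blast
  next
    fix f assume "(\<forall>i. f i \<in> G i) \<and> finite {i. f i \<noteq> \<zero>\<^bsub>M\<^esub>} \<and> x = (\<Oplus>\<^bsub>M\<^esub>i\<in>{i. f i \<noteq> \<zero>\<^bsub>M\<^esub>}. f i)"
    then show "f = (\<lambda>i. pr i x)" using pr_sum by auto
  qed
qed

section \<open>Direct sums of bigraded pieces\<close>

definition bisupport :: "(int \<Rightarrow> int \<Rightarrow> ('a, 'm) ring_scheme) \<Rightarrow> (int \<Rightarrow> int \<Rightarrow> 'a) \<Rightarrow> (int \<times> int) set"
  where "bisupport C f = {(i, n). f i n \<noteq> \<zero>\<^bsub>C i n\<^esub>}"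

lemma bigraded_sum_simps:
  "carrier (bigraded_sum C) = {f. (\<forall>i n. f i n \<in> carrier (C i n)) \<and> finite (bisupport C f)}"
  "mult (bigraded_sum C) f g k l =
     (\<Oplus>\<^bsub>C k l\<^esub>p\<in>bisupport C f. f (fst p) (snd p) \<otimes>\<^bsub>C k l\<^esub> g (k - fst p) (l - snd p))"
  "zero (bigraded_sum C) i n = \<zero>\<^bsub>C i n\<^esub>"
  "add (bigraded_sum C) f g i n = f i n \<oplus>\<^bsub>C i n\<^esub> g i n"
  "smult (bigraded_sum C) c f i n = c \<odot>\<^bsub>C i n\<^esub> f i n"
  "differential (bigraded_sum C) f i n = \<partial>\<^bsub>C i n\<^esub> (f (i - 1) n)"
  by (simp_all add: bigraded_sum_def Let_def bisupport_def)

text \<open>Degree parts, weight parts, the whole sum and the intersections of these are all of this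
  form, so that one statement about \<open>supported_part\<close> covers every grading that is needed.\<close>

definition supported_part ::
  "(int \<Rightarrow> int \<Rightarrow> ('k, 'a, 'm) dmodule_scheme) \<Rightarrow> (int \<times> int) set \<Rightarrow> (int \<Rightarrow> int \<Rightarrow> 'a) set"
  where "supported_part C T = {f \<in> carrier (bigraded_sum C). bisupport C f \<subseteq> T}"

lemma graded_parts_supported:
  "degree_part (bigraded_sum C) i = supported_part C (fst -` {i})"
  "weight_part (bigraded_sum C) n = supported_part C (snd -` {n})"
  "carrier (bigraded_sum C) = supported_part C UNIV"
proof -
  have "bisupport C f \<subseteq> fst -` {i} \<longleftrightarrow> (\<forall>j n. j \<noteq> i \<longrightarrow> f j n = \<zero>\<^bsub>C j n\<^esub>)"
    "bisupport C f \<subseteq> snd -` {n} \<longleftrightarrow> (\<forall>i m. m \<noteq> n \<longrightarrow> f i m = \<zero>\<^bsub>C i m\<^esub>)" for f i n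
    by (simp_all add: bisupport_def subset_iff) blast+
  then show "degree_part (bigraded_sum C) i = supported_part C (fst -` {i})"
    "weight_part (bigraded_sum C) n = supported_part C (snd -` {n})"
    "carrier (bigraded_sum C) = supported_part C UNIV"
    unfolding supported_part_def
    by (simp_all add: bigraded_sum_def Let_def)
qed

lemma supported_part_Int: "supported_part C S \<inter> supported_part C T = supported_part C (S \<inter> T)"
  by (auto simp: supported_part_def)

text \<open>The axioms of a bigraded dg algebra, for homogeneous elements only. As in
  \<^const>\<open>bigraded_sum\<close>, the multiplication of \<open>C k l\<close> takes its second factor from
  \<open>C (k - i) (l - n)\<close> if the first lies in \<open>C i n\<close>; this form avoids rewriting
  along equations between the indices of the target.\<close>

locale bigraded_dg_pieces = field R
  for R :: "('k, 'r) ring_scheme" (structure)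
    and C :: "int \<Rightarrow> int \<Rightarrow> ('k, 'a, 'm) dmodule_scheme" +
  assumes piece_module: "module R (C i n)"
    and piece_mult_left:
      "y \<in> carrier (C (k - i) (l - n)) \<Longrightarrow> linear_map R (C i n) (C k l) (\<lambda>x. x \<otimes>\<^bsub>C k l\<^esub> y)"
    and piece_mult_right:
      "x \<in> carrier (C i n) \<Longrightarrow> linear_map R (C (k - i) (l - n)) (C k l) (\<lambda>y. x \<otimes>\<^bsub>C k l\<^esub> y)"
    and piece_assoc:
      "\<lbrakk>x \<in> carrier (C i n); y \<in> carrier (C j m); z \<in> carrier (C (k - i - j) (l - n - m))\<rbrakk> \<Longrightarrow>
         (x \<otimes>\<^bsub>C (i + j) (n + m)\<^esub> y) \<otimes>\<^bsub>C k l\<^esub> z = x \<otimes>\<^bsub>C k l\<^esub> (y \<otimes>\<^bsub>C (k - i) (l - n)\<^esub> z)"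
    and piece_d_linear: "linear_map R (C i n) (C (i + 1) n) \<partial>\<^bsub>C (i + 1) n\<^esub>"
    and piece_d_square:
      "x \<in> carrier (C i n) \<Longrightarrow> \<partial>\<^bsub>C (i + 2) n\<^esub> (\<partial>\<^bsub>C (i + 1) n\<^esub> x) = \<zero>\<^bsub>C (i + 2) n\<^esub>"
    and piece_Leibniz:
      "\<lbrakk>x \<in> carrier (C i n); y \<in> carrier (C (k - i - 1) (l - n))\<rbrakk> \<Longrightarrow>
         \<partial>\<^bsub>C k l\<^esub> (x \<otimes>\<^bsub>C (k - 1) l\<^esub> y) =
           \<partial>\<^bsub>C (i + 1) n\<^esub> x \<otimes>\<^bsub>C k l\<^esub> y \<oplus>\<^bsub>C k l\<^esub> koszul (C k l) i (x \<otimes>\<^bsub>C k l\<^esub> \<partial>\<^bsub>C (k - i) (l - n)\<^esub> y)"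
begin

abbreviation B where "B \<equiv> bigraded_sum C"

lemma piece_abelian_group: "abelian_group (C i n)"
  using piece_module by (rule module.axioms)

lemma bigraded_sumD:
  assumes "f \<in> carrier B"
  shows "f i n \<in> carrier (C i n)" "finite (bisupport C f)"
  using assms by (auto simp: bigraded_sum_simps)

lemma bigraded_sumI:
  assumes "\<And>i n. f i n \<in> carrier (C i n)" "finite S" "bisupport C f \<subseteq> S"
  shows "f \<in> carrier B"
  using assms finite_subset by (auto simp: bigraded_sum_simps)

lemma piece_zero_closed [simp]: "\<zero>\<^bsub>C i n\<^esub> \<in> carrier (C i n)"
  using piece_abelian_group abelian_groupE(2) by blast

lemma piece_minus_eq_zero_iff:
  "x \<in> carrier (C i n) \<Longrightarrow> \<ominus>\<^bsub>C i n\<^esub> x = \<zero>\<^bsub>C i n\<^esub> \<longleftrightarrow> x = \<zero>\<^bsub>C i n\<^esub>"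
proof -
  interpret abelian_group "C i n" by (rule piece_abelian_group)
  show "x \<in> carrier (C i n) \<Longrightarrow> ?thesis" by (simp add: add.inv_eq_1_iff)
qed

lemma piece_mult_closed:
  "\<lbrakk>x \<in> carrier (C i n); y \<in> carrier (C (k - i) (l - n))\<rbrakk> \<Longrightarrow> x \<otimes>\<^bsub>C k l\<^esub> y \<in> carrier (C k l)"
  using linear_mapD(1)[OF piece_mult_left] by blast

lemma piece_mult_zero_left:
  "y \<in> carrier (C (k - i) (l - n)) \<Longrightarrow> \<zero>\<^bsub>C i n\<^esub> \<otimes>\<^bsub>C k l\<^esub> y = \<zero>\<^bsub>C k l\<^esub>"
  using linear_map_zero[OF piece_mult_left piece_module piece_module] .

lemma piece_mult_zero_right:
  "x \<in> carrier (C i n) \<Longrightarrow> x \<otimes>\<^bsub>C k l\<^esub> \<zero>\<^bsub>C (k - i) (l - n)\<^esub> = \<zero>\<^bsub>C k l\<^esub>"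
  using linear_map_zero[OF piece_mult_right piece_module piece_module] .

lemma piece_d_linear': "linear_map R (C (i - 1) n) (C i n) \<partial>\<^bsub>C i n\<^esub>"
  using piece_d_linear[of "i - 1" n] by simp

lemma piece_d_zero: "\<partial>\<^bsub>C i n\<^esub> \<zero>\<^bsub>C (i - 1) n\<^esub> = \<zero>\<^bsub>C i n\<^esub>"
  using linear_map_zero[OF piece_d_linear' piece_module piece_module] .

lemma bigraded_sum_add_closed:
  assumes "f \<in> carrier B" "g \<in> carrier B"
  shows "f \<oplus>\<^bsub>B\<^esub> g \<in> carrier B" "bisupport C (f \<oplus>\<^bsub>B\<^esub> g) \<subseteq> bisupport C f \<union> bisupport C g"
proof -
  show *: "bisupport C (f \<oplus>\<^bsub>B\<^esub> g) \<subseteq> bisupport C f \<union> bisupport C g"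
    using abelian_groupE(5)[OF piece_abelian_group]
    by (auto simp: bisupport_def bigraded_sum_simps)
  show "f \<oplus>\<^bsub>B\<^esub> g \<in> carrier B"
    using assms by (intro bigraded_sumI[OF _ _ *])
      (auto simp: bigraded_sum_simps intro: abelian_groupE(1)[OF piece_abelian_group])
qed

lemma bigraded_sum_smult_closed:
  assumes "c \<in> carrier R" "f \<in> carrier B"
  shows "c \<odot>\<^bsub>B\<^esub> f \<in> carrier B" "bisupport C (c \<odot>\<^bsub>B\<^esub> f) \<subseteq> bisupport C f"
proof -
  show *: "bisupport C (c \<odot>\<^bsub>B\<^esub> f) \<subseteq> bisupport C f"
    using assms(1) module.smult_r_null[OF piece_module]
    by (auto simp: bisupport_def bigraded_sum_simps)
  show "c \<odot>\<^bsub>B\<^esub> f \<in> carrier B"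
    using assms by (intro bigraded_sumI[OF _ _ *])
      (auto simp: bigraded_sum_simps intro: module.smult_closed[OF piece_module])
qed

lemma bisupport_zero [simp]: "bisupport C \<zero>\<^bsub>B\<^esub> = {}"
  by (auto simp: bisupport_def bigraded_sum_simps)

lemma bigraded_sum_zero_closed: "\<zero>\<^bsub>B\<^esub> \<in> carrier B"
  by (auto simp: bigraded_sum_simps(1)) (simp add: bigraded_sum_simps)

lemma bigraded_sum_abelian_group: "abelian_group B"
proof (rule abelian_groupI)
  fix f assume f: "f \<in> carrier B"
  define g where "g i n = \<ominus>\<^bsub>C i n\<^esub> f i n" for i n
  have "g \<in> carrier B"
  proof (rule bigraded_sumI)
    show "g i n \<in> carrier (C i n)" for i n
      unfolding g_def using abelian_group.a_inv_closed[OF piece_abelian_group] bigraded_sumD(1)[OF f] .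
    show "bisupport C g \<subseteq> bisupport C f"
    proof -
      show ?thesis by (auto simp: bisupport_def g_def piece_minus_eq_zero_iff bigraded_sumD(1)[OF f])
    qed
  qed (rule bigraded_sumD(2)[OF f])
  moreover have "g \<oplus>\<^bsub>B\<^esub> f = \<zero>\<^bsub>B\<^esub>"
    using bigraded_sumD(1)[OF f] abelian_group.l_neg[OF piece_abelian_group]
    by (simp add: fun_eq_iff bigraded_sum_simps g_def)
  ultimately show "\<exists>g\<in>carrier B. g \<oplus>\<^bsub>B\<^esub> f = \<zero>\<^bsub>B\<^esub>" by blast
next
  show "f \<oplus>\<^bsub>B\<^esub> g = g \<oplus>\<^bsub>B\<^esub> f" if "f \<in> carrier B" "g \<in> carrier B" for f g
    using bigraded_sumD(1)[OF that(1)] bigraded_sumD(1)[OF that(2)]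
    by (simp add: fun_eq_iff bigraded_sum_simps(4) abelian_groupE(4)[OF piece_abelian_group])
qed (simp_all add: bigraded_sum_add_closed bigraded_sum_zero_closed,
     simp_all add: fun_eq_iff bigraded_sum_simps abelian_groupE(3,5)[OF piece_abelian_group])

lemma bigraded_sum_module: "module R B"
proof (rule moduleI)
  show "cring R" by (rule is_cring)
qed (simp_all add: bigraded_sum_abelian_group bigraded_sum_smult_closed,
     simp_all add: fun_eq_iff bigraded_sum_simps module.smult_l_distr[OF piece_module]
       module.smult_r_distr[OF piece_module] module.smult_assoc1[OF piece_module]
       module.smult_one[OF piece_module])

lemma bigraded_sum_minus:
  assumes "f \<in> carrier B"
  shows "(\<ominus>\<^bsub>B\<^esub> f) i n = \<ominus>\<^bsub>C i n\<^esub> f i n"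
proof -
  interpret B: abelian_group B by (rule bigraded_sum_abelian_group)
  interpret C: abelian_group "C i n" by (rule piece_abelian_group)
  have "(\<ominus>\<^bsub>B\<^esub> f) i n \<oplus>\<^bsub>C i n\<^esub> f i n = \<zero>\<^bsub>C i n\<^esub>"
    using B.l_neg[OF assms] by (metis bigraded_sum_simps(3,4))
  then show ?thesis
    using C.minus_equality[of "(\<ominus>\<^bsub>B\<^esub> f) i n" "f i n"] bigraded_sumD(1)[OF assms]
      bigraded_sumD(1)[OF B.a_inv_closed[OF assms]] by simp
qed

lemma bigraded_sum_koszul:
  "f \<in> carrier B \<Longrightarrow> koszul B p f i n = koszul (C i n) p (f i n)"
  by (simp add: koszul_def bigraded_sum_minus)

lemma supported_part_submodule: "submodule (supported_part C T) R B"
proof -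
  interpret B: module R B by (rule bigraded_sum_module)
  show ?thesis
  proof (rule B.submoduleI)
    fix f assume f: "f \<in> supported_part C T"
    then have "f \<in> carrier B" by (simp add: supported_part_def)
    then have "bisupport C (\<ominus>\<^bsub>B\<^esub> f) = bisupport C f"
      using bigraded_sumD(1) by (simp add: bisupport_def bigraded_sum_minus piece_minus_eq_zero_iff)
    with f show "\<ominus>\<^bsub>B\<^esub> f \<in> supported_part C T" by (simp add: supported_part_def)
  next
    fix f g assume "f \<in> supported_part C T" "g \<in> supported_part C T"
    then show "f \<oplus>\<^bsub>B\<^esub> g \<in> supported_part C T"
      using bigraded_sum_add_closed[of f g] by (simp add: supported_part_def) blast
  next
    fix c f assume "c \<in> carrier R" "f \<in> supported_part C T"
    then show "c \<odot>\<^bsub>B\<^esub> f \<in> supported_part C T"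
      using bigraded_sum_smult_closed[of c f] by (simp add: supported_part_def) blast
  qed (auto simp: supported_part_def bigraded_sum_zero_closed)
qed

text \<open>Three gradings are obtained from this: by degree (\<open>T = UNIV\<close>, \<open>deg = fst\<close>), by weight
  (\<open>T = UNIV\<close>, \<open>deg = snd\<close>), and the grading by degree of a single part of
  weight \<open>n\<close> (\<open>T = snd -` {n}\<close>, \<open>deg = fst\<close>).\<close>

lemma supported_part_grading:
  fixes deg :: "int \<times> int \<Rightarrow> int"
  shows "internal_grading R (B\<lparr>carrier := supported_part C T\<rparr>)
           (\<lambda>i. supported_part C (T \<inter> deg -` {i}))"
proof -
  let ?N = "B\<lparr>carrier := supported_part C T\<rparr>"
  define pr where "pr a f = (\<lambda>i n. if deg (i, n) = a then f i n else \<zero>\<^bsub>C i n\<^esub>)"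
    for a and f :: "int \<Rightarrow> int \<Rightarrow> 'a"
  interpret B: module R B by (rule bigraded_sum_module)
  have N: "module R ?N"
    using submodule.submodule_is_module[OF supported_part_submodule bigraded_sum_module] .
  interpret N: module R ?N by (rule N)
  have supp_pr: "bisupport C (pr a f) = bisupport C f \<inter> deg -` {a}" for a f
    by (auto simp: bisupport_def pr_def)
  have pr_closed: "pr a f \<in> supported_part C (T \<inter> deg -` {a})" if "f \<in> supported_part C T" for a f
    using that by (auto simp: supported_part_def supp_pr bigraded_sum_simps(1)) (auto simp: pr_def)
  have supp_deg: "f j n = \<zero>\<^bsub>C j n\<^esub>"
    if "f \<in> supported_part C (T \<inter> deg -` {i})" "deg (j, n) \<noteq> i" for f i j n
    using that unfolding supported_part_def bisupport_def by blast
  show ?thesis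
  proof (rule internal_gradingI[OF N, where pr = pr])
    show "submodule (supported_part C (T \<inter> deg -` {i})) R ?N" for i
    proof (rule N.module_incl_imp_submodule)
      show "module R (?N\<lparr>carrier := supported_part C (T \<inter> deg -` {i})\<rparr>)"
        using submodule.submodule_is_module[OF supported_part_submodule bigraded_sum_module]
        by simp
    qed (auto simp: supported_part_def)
    show "linear_map R ?N ?N (pr i)" for i
      using pr_closed[of _ i] abelian_groupE(5)[OF piece_abelian_group]
        module.smult_r_null[OF piece_module]
      by (auto simp: linear_map_def fun_eq_iff bigraded_sum_simps pr_def supported_part_def)
    show "pr i f = f" if "f \<in> supported_part C (T \<inter> deg -` {i})" for i f
      using supp_deg[OF that] by (auto simp: fun_eq_iff pr_def)
    show "pr j f = \<zero>\<^bsub>?N\<^esub>" if "f \<in> supported_part C (T \<inter> deg -` {i})" "j \<noteq> i" for i j f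
      using supp_deg[OF that(1)] that(2) by (auto simp: fun_eq_iff pr_def bigraded_sum_simps(3))
    show "finite {i. pr i f \<noteq> \<zero>\<^bsub>?N\<^esub>}" if "f \<in> carrier ?N" for f
    proof (rule finite_subset)
      show "{i. pr i f \<noteq> \<zero>\<^bsub>?N\<^esub>} \<subseteq> deg ` bisupport C f"
      proof
        fix a assume "a \<in> {i. pr i f \<noteq> \<zero>\<^bsub>?N\<^esub>}"
        then obtain i n where "pr a f i n \<noteq> zero ?N i n" by (auto simp: fun_eq_iff)
        then have "(i, n) \<in> bisupport C f" "a = deg (i, n)"
          by (auto simp: pr_def bisupport_def bigraded_sum_simps split: if_splits)
        then show "a \<in> deg ` bisupport C f" by blast
      qed
      show "finite (deg ` bisupport C f)"
        using that by (simp add: supported_part_def bigraded_sum_simps(1))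
    qed
    show "f = \<zero>\<^bsub>?N\<^esub>" if "\<And>a. pr a f = \<zero>\<^bsub>?N\<^esub>" for f
    proof (intro ext)
      fix i n
      show "f i n = zero ?N i n"
        using fun_cong[OF fun_cong[OF that[of "deg (i, n)"]], of i n] by (simp add: pr_def)
    qed
  qed (use pr_closed in auto)
qed

text \<open>The product is a sum over the support of the first factor, which changes when that factor
  does. Any finite superset may be used instead, so that sums with different first factors can be
  put over a common index set.\<close>

lemma bigraded_sum_mult_eq:
  assumes f: "f \<in> carrier B" and g: "g \<in> carrier B" and S: "finite S" "bisupport C f \<subseteq> S"
  shows "(f \<otimes>\<^bsub>B\<^esub> g) k l =
    (\<Oplus>\<^bsub>C k l\<^esub>p\<in>S. f (fst p) (snd p) \<otimes>\<^bsub>C k l\<^esub> g (k - fst p) (l - snd p))"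
proof -
  interpret C: abelian_group "C k l" by (rule piece_abelian_group)
  show ?thesis unfolding bigraded_sum_simps(2)
    using S bigraded_sumD(1)[OF f] bigraded_sumD(1)[OF g]
    by (intro C.add.finprod_mono_neutral_cong_left)
      (auto simp: bisupport_def piece_mult_zero_left
        intro!: piece_mult_closed[OF bigraded_sumD(1)[OF f] bigraded_sumD(1)[OF g]])
qed

lemma bisupport_mult:
  assumes f: "f \<in> carrier B" and g: "g \<in> carrier B"
  shows "bisupport C (f \<otimes>\<^bsub>B\<^esub> g) \<subseteq>
    (\<lambda>(p, q). (fst p + fst q, snd p + snd q)) ` (bisupport C f \<times> bisupport C g)"
    (is "_ \<subseteq> ?T")
proof clarify
  fix k l assume kl: "(k, l) \<in> bisupport C (f \<otimes>\<^bsub>B\<^esub> g)"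
  interpret C: abelian_group "C k l" by (rule piece_abelian_group)
  show "(k, l) \<in> ?T"
  proof (rule ccontr)
    assume nT: "(k, l) \<notin> ?T"
    have "f i n \<otimes>\<^bsub>C k l\<^esub> g (k - i) (l - n) = \<zero>\<^bsub>C k l\<^esub>"
      if "(i, n) \<in> bisupport C f" for i n
    proof -
      have "(k - i, l - n) \<notin> bisupport C g"
        using nT that by force
      then show ?thesis
        using piece_mult_zero_right[OF bigraded_sumD(1)[OF f]] by (simp add: bisupport_def)
    qed
    then have "(f \<otimes>\<^bsub>B\<^esub> g) k l = \<zero>\<^bsub>C k l\<^esub>"
      unfolding bigraded_sum_simps(2) by (intro C.add.finprod_one_eqI) auto
    with kl show False by (simp add: bisupport_def)
  qed
qed

lemma bigraded_sum_mult_closed: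
  assumes f: "f \<in> carrier B" and g: "g \<in> carrier B"
  shows "f \<otimes>\<^bsub>B\<^esub> g \<in> carrier B"
proof (rule bigraded_sumI[OF _ _ bisupport_mult[OF assms]])
  show "(f \<otimes>\<^bsub>B\<^esub> g) k l \<in> carrier (C k l)" for k l
  proof -
    interpret C: abelian_group "C k l" by (rule piece_abelian_group)
    show ?thesis unfolding bigraded_sum_simps(2)
      using piece_mult_closed[OF bigraded_sumD(1)[OF f] bigraded_sumD(1)[OF g]]
      by (intro C.finsum_closed) auto
  qed
qed (use assms bigraded_sumD(2) in auto)

lemma bigraded_sum_mult_linear_left:
  assumes g: "g \<in> carrier B"
  shows "linear_map R B B (\<lambda>f. f \<otimes>\<^bsub>B\<^esub> g)"
  unfolding linear_map_def
proof (intro conjI ballI funcsetI ext)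
  fix f assume f: "f \<in> carrier B"
  show "f \<otimes>\<^bsub>B\<^esub> g \<in> carrier B" using f g by (rule bigraded_sum_mult_closed)
  note gc = bigraded_sumD(1)[OF g] and fc = bigraded_sumD(1)[OF f] and fs = bigraded_sumD(2)[OF f]
  note mc = piece_mult_closed[OF fc gc]
  show "((c \<odot>\<^bsub>B\<^esub> f) \<otimes>\<^bsub>B\<^esub> g) k l = (c \<odot>\<^bsub>B\<^esub> (f \<otimes>\<^bsub>B\<^esub> g)) k l" if c: "c \<in> carrier R" for c k l
  proof -
    interpret C: module R "C k l" by (rule piece_module)
    have "((c \<odot>\<^bsub>B\<^esub> f) \<otimes>\<^bsub>B\<^esub> g) k l = (\<Oplus>\<^bsub>C k l\<^esub>p\<in>bisupport C f.
        (c \<odot>\<^bsub>C (fst p) (snd p)\<^esub> f (fst p) (snd p)) \<otimes>\<^bsub>C k l\<^esub> g (k - fst p) (l - snd p))"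
      using bigraded_sum_mult_eq[OF bigraded_sum_smult_closed(1)[OF c f] g fs
          bigraded_sum_smult_closed(2)[OF c f]]
      by (simp add: bigraded_sum_simps(5))
    also have "\<dots> = (\<Oplus>\<^bsub>C k l\<^esub>p\<in>bisupport C f.
        c \<odot>\<^bsub>C k l\<^esub> (f (fst p) (snd p) \<otimes>\<^bsub>C k l\<^esub> g (k - fst p) (l - snd p)))"
      using fc gc c by (intro C.finsum_cong')
        (auto simp: linear_mapD(3)[OF piece_mult_left[OF gc]] intro!: mc C.smult_closed)
    also have "\<dots> = (c \<odot>\<^bsub>B\<^esub> (f \<otimes>\<^bsub>B\<^esub> g)) k l"
      unfolding bigraded_sum_simps(5) bigraded_sum_simps(2)
      using fc gc by (intro C.finsum_smult_ldistr[symmetric] c fs) (auto intro: mc)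
    finally show ?thesis .
  qed
  show "((f \<oplus>\<^bsub>B\<^esub> h) \<otimes>\<^bsub>B\<^esub> g) k l = ((f \<otimes>\<^bsub>B\<^esub> g) \<oplus>\<^bsub>B\<^esub> (h \<otimes>\<^bsub>B\<^esub> g)) k l" if h: "h \<in> carrier B" for h k l
  proof -
    interpret C: module R "C k l" by (rule piece_module)
    note hc = bigraded_sumD(1)[OF h] and hs = bigraded_sumD(2)[OF h]
    note mc = piece_mult_closed[OF fc gc] piece_mult_closed[OF hc gc]
    let ?S = "bisupport C f \<union> bisupport C h"
    have S: "finite ?S" using fs hs by auto
    have "((f \<oplus>\<^bsub>B\<^esub> h) \<otimes>\<^bsub>B\<^esub> g) k l = (\<Oplus>\<^bsub>C k l\<^esub>p\<in>?S.
        (f (fst p) (snd p) \<oplus>\<^bsub>C (fst p) (snd p)\<^esub> h (fst p) (snd p)) \<otimes>\<^bsub>C k l\<^esub> g (k - fst p) (l - snd p))"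
      using bigraded_sum_mult_eq[OF bigraded_sum_add_closed(1)[OF f h] g S
          bigraded_sum_add_closed(2)[OF f h]]
      by (simp add: bigraded_sum_simps(4))
    also have "\<dots> = (\<Oplus>\<^bsub>C k l\<^esub>p\<in>?S. f (fst p) (snd p) \<otimes>\<^bsub>C k l\<^esub> g (k - fst p) (l - snd p)
        \<oplus>\<^bsub>C k l\<^esub> h (fst p) (snd p) \<otimes>\<^bsub>C k l\<^esub> g (k - fst p) (l - snd p))"
      using fc gc hc by (intro C.finsum_cong')
        (auto simp: linear_mapD(2)[OF piece_mult_left[OF gc]] intro!: mc C.add.m_closed)
    also have "\<dots> = (f \<otimes>\<^bsub>B\<^esub> g) k l \<oplus>\<^bsub>C k l\<^esub> (h \<otimes>\<^bsub>B\<^esub> g) k l"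
      using fc gc hc unfolding bigraded_sum_mult_eq[OF f g S Un_upper1]
        bigraded_sum_mult_eq[OF h g S Un_upper2]
      by (intro C.finsum_addf) (auto intro: mc)
    finally show ?thesis by (simp add: bigraded_sum_simps(4))
  qed
qed

lemma bigraded_sum_mult_linear_right:
  assumes f: "f \<in> carrier B"
  shows "linear_map R B B (\<lambda>g. f \<otimes>\<^bsub>B\<^esub> g)"
  unfolding linear_map_def
proof (intro conjI ballI funcsetI ext)
  note fc = bigraded_sumD(1)[OF f] and fs = bigraded_sumD(2)[OF f]
  fix g assume g: "g \<in> carrier B"
  note gc = bigraded_sumD(1)[OF g]
  note mc = piece_mult_closed[OF fc gc]
  show "f \<otimes>\<^bsub>B\<^esub> g \<in> carrier B" using f g by (rule bigraded_sum_mult_closed)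
  show "(f \<otimes>\<^bsub>B\<^esub> (c \<odot>\<^bsub>B\<^esub> g)) k l = (c \<odot>\<^bsub>B\<^esub> (f \<otimes>\<^bsub>B\<^esub> g)) k l" if c: "c \<in> carrier R" for c k l
  proof -
    interpret C: module R "C k l" by (rule piece_module)
    have "(f \<otimes>\<^bsub>B\<^esub> (c \<odot>\<^bsub>B\<^esub> g)) k l = (\<Oplus>\<^bsub>C k l\<^esub>p\<in>bisupport C f.
        c \<odot>\<^bsub>C k l\<^esub> (f (fst p) (snd p) \<otimes>\<^bsub>C k l\<^esub> g (k - fst p) (l - snd p)))"
      unfolding bigraded_sum_simps(2) bigraded_sum_simps(5)
      using fc gc c by (intro C.finsum_cong')
        (auto simp: linear_mapD(3)[OF piece_mult_right[OF fc]] intro!: mc C.smult_closed)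
    also have "\<dots> = (c \<odot>\<^bsub>B\<^esub> (f \<otimes>\<^bsub>B\<^esub> g)) k l"
      unfolding bigraded_sum_simps(5) bigraded_sum_simps(2)
      using fc gc by (intro C.finsum_smult_ldistr[symmetric] c fs) (auto intro: mc)
    finally show ?thesis .
  qed
  show "(f \<otimes>\<^bsub>B\<^esub> (g \<oplus>\<^bsub>B\<^esub> h)) k l = ((f \<otimes>\<^bsub>B\<^esub> g) \<oplus>\<^bsub>B\<^esub> (f \<otimes>\<^bsub>B\<^esub> h)) k l" if h: "h \<in> carrier B" for h k l
  proof -
    interpret C: module R "C k l" by (rule piece_module)
    note hc = bigraded_sumD(1)[OF h]
    note mc = mc piece_mult_closed[OF fc hc]
    have "(f \<otimes>\<^bsub>B\<^esub> (g \<oplus>\<^bsub>B\<^esub> h)) k l = (\<Oplus>\<^bsub>C k l\<^esub>p\<in>bisupport C f.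
        f (fst p) (snd p) \<otimes>\<^bsub>C k l\<^esub> g (k - fst p) (l - snd p)
        \<oplus>\<^bsub>C k l\<^esub> f (fst p) (snd p) \<otimes>\<^bsub>C k l\<^esub> h (k - fst p) (l - snd p))"
      unfolding bigraded_sum_simps(2) bigraded_sum_simps(4)
      using fc gc hc by (intro C.finsum_cong')
        (auto simp: linear_mapD(2)[OF piece_mult_right[OF fc]] intro!: mc C.add.m_closed)
    also have "\<dots> = ((f \<otimes>\<^bsub>B\<^esub> g) \<oplus>\<^bsub>B\<^esub> (f \<otimes>\<^bsub>B\<^esub> h)) k l"
      unfolding bigraded_sum_simps(4) bigraded_sum_simps(2)
      using fc gc hc by (intro C.finsum_addf) (auto intro: mc)
    finally show ?thesis .
  qed
qed

end

context bigraded_dg_pieces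
begin

text \<open>Both sides are the sum of \<open>f\<^sub>q (g\<^sub>r h\<^sub>s)\<close> over all \<open>q + r + s = (k, l)\<close>. On the left the outer sum
  runs over \<open>p = q + r\<close>; after exchanging the sums, \<open>p\<close> is replaced by \<open>r = p - q\<close>.\<close>

lemma bigraded_sum_mult_assoc:
  assumes f: "f \<in> carrier B" and g: "g \<in> carrier B" and h: "h \<in> carrier B"
  shows "(f \<otimes>\<^bsub>B\<^esub> g) \<otimes>\<^bsub>B\<^esub> h = f \<otimes>\<^bsub>B\<^esub> (g \<otimes>\<^bsub>B\<^esub> h)"
proof (intro ext)
  fix k l
  interpret C: module R "C k l" by (rule piece_module)
  note fc = bigraded_sumD(1)[OF f] and gc = bigraded_sumD(1)[OF g] and hc = bigraded_sumD(1)[OF h]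
  note fg = bigraded_sum_mult_closed[OF f g]
  \<comment> \<open>contains the support of \<open>f g\<close> and, shifted back by any \<open>q\<close> in the support of \<open>f\<close>, that of \<open>g\<close>\<close>
  define S where "S = (\<lambda>(p, q). (fst p + fst q, snd p + snd q)) ` (bisupport C f \<times> bisupport C g)"
  have S: "finite S" "bisupport C (f \<otimes>\<^bsub>B\<^esub> g) \<subseteq> S"
    using bigraded_sumD(2)[OF f] bigraded_sumD(2)[OF g] bisupport_mult[OF f g] by (auto simp: S_def)
  let ?t = "\<lambda>q r. f (fst q) (snd q) \<otimes>\<^bsub>C k l\<^esub> (g (fst r) (snd r)
    \<otimes>\<^bsub>C (k - fst q) (l - snd q)\<^esub> h (k - fst q - fst r) (l - snd q - snd r))"
  have t: "?t q r \<in> carrier (C k l)" for q r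
    by (rule piece_mult_closed[OF fc piece_mult_closed[OF gc hc]])
  have "((f \<otimes>\<^bsub>B\<^esub> g) \<otimes>\<^bsub>B\<^esub> h) k l =
      (\<Oplus>\<^bsub>C k l\<^esub>p\<in>S. \<Oplus>\<^bsub>C k l\<^esub>q\<in>bisupport C f. ?t q (fst p - fst q, snd p - snd q))"
    unfolding bigraded_sum_mult_eq[OF fg h S]
  proof (rule C.finsum_cong'[OF refl])
    fix p assume "p \<in> S"
    let ?x = "\<lambda>q. f (fst q) (snd q) \<otimes>\<^bsub>C (fst p) (snd p)\<^esub> g (fst p - fst q) (snd p - snd q)"
    have "(f \<otimes>\<^bsub>B\<^esub> g) (fst p) (snd p) \<otimes>\<^bsub>C k l\<^esub> h (k - fst p) (l - snd p)
      = (\<Oplus>\<^bsub>C k l\<^esub>q\<in>bisupport C f. ?x q \<otimes>\<^bsub>C k l\<^esub> h (k - fst p) (l - snd p))"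
      unfolding bigraded_sum_simps(2)
      by (rule linear_map_finsum[OF piece_mult_left[OF hc] piece_module piece_module])
        (auto intro: piece_mult_closed[OF fc gc])
    also have "\<dots> = (\<Oplus>\<^bsub>C k l\<^esub>q\<in>bisupport C f. ?t q (fst p - fst q, snd p - snd q))"
    proof (rule C.finsum_cong'[OF refl])
      fix q
      show "?x q \<otimes>\<^bsub>C k l\<^esub> h (k - fst p) (l - snd p) = ?t q (fst p - fst q, snd p - snd q)"
        using piece_assoc[OF fc gc hc, where i = "fst q" and n = "snd q"
            and j = "fst p - fst q" and m = "snd p - snd q" and k = k and l = l]
        by (simp add: algebra_simps)
    qed (rule Pi_I, rule t)
    finally show "(f \<otimes>\<^bsub>B\<^esub> g) (fst p) (snd p) \<otimes>\<^bsub>C k l\<^esub> h (k - fst p) (l - snd p)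
      = (\<Oplus>\<^bsub>C k l\<^esub>q\<in>bisupport C f. ?t q (fst p - fst q, snd p - snd q))" .
  qed (intro Pi_I C.finsum_closed t)
  also have "\<dots> = (\<Oplus>\<^bsub>C k l\<^esub>q\<in>bisupport C f. \<Oplus>\<^bsub>C k l\<^esub>p\<in>S. ?t q (fst p - fst q, snd p - snd q))"
    using t by (intro C.finsum_swap S bigraded_sumD(2)[OF f])
  also have "\<dots> = (f \<otimes>\<^bsub>B\<^esub> (g \<otimes>\<^bsub>B\<^esub> h)) k l"
    unfolding bigraded_sum_simps(2)[of C f]
  proof (rule C.finsum_cong'[OF refl])
    fix q assume q: "q \<in> bisupport C f"
    let ?sh = "\<lambda>p. (fst p - fst q, snd p - snd q)"
    have T: "finite (?sh ` S)" "bisupport C g \<subseteq> ?sh ` S"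
    proof -
      show "bisupport C g \<subseteq> ?sh ` S"
      proof
        fix r assume "r \<in> bisupport C g"
        then have "(fst q + fst r, snd q + snd r) \<in> S" using q unfolding S_def by force
        then show "r \<in> ?sh ` S" by force
      qed
    qed (use S in auto)
    have "(\<Oplus>\<^bsub>C k l\<^esub>p\<in>S. ?t q (?sh p)) = (\<Oplus>\<^bsub>C k l\<^esub>r\<in>?sh ` S. ?t q r)"
      using t by (intro C.finsum_reindex[symmetric]) (auto simp: inj_on_def prod_eq_iff)
    also have "\<dots> = f (fst q) (snd q) \<otimes>\<^bsub>C k l\<^esub> (g \<otimes>\<^bsub>B\<^esub> h) (k - fst q) (l - snd q)"
      unfolding bigraded_sum_mult_eq[OF g h T]
      by (rule linear_map_finsum[OF piece_mult_right[OF fc] piece_module piece_module, symmetric])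
        (auto intro: piece_mult_closed[OF gc hc])
    finally show "(\<Oplus>\<^bsub>C k l\<^esub>p\<in>S. ?t q (?sh p))
      = f (fst q) (snd q) \<otimes>\<^bsub>C k l\<^esub> (g \<otimes>\<^bsub>B\<^esub> h) (k - fst q) (l - snd q)" .
  qed (auto intro!: piece_mult_closed[OF fc bigraded_sumD(1)[OF bigraded_sum_mult_closed[OF g h]]])
  finally show "((f \<otimes>\<^bsub>B\<^esub> g) \<otimes>\<^bsub>B\<^esub> h) k l = (f \<otimes>\<^bsub>B\<^esub> (g \<otimes>\<^bsub>B\<^esub> h)) k l" .
qed

lemma bigraded_sum_assoc_algebra: "assoc_algebra R B"
  by (intro assoc_algebra.intro field_axioms bigraded_sum_module assoc_algebra_axioms.intro
      bigraded_sum_mult_closed bigraded_sum_mult_assoc bigraded_sum_mult_linear_left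
      bigraded_sum_mult_linear_right)

lemma bisupport_d:
  "bisupport C (\<partial>\<^bsub>B\<^esub> f) \<subseteq> (\<lambda>p. (fst p + 1, snd p)) ` bisupport C f"
proof clarify
  fix i n assume "(i, n) \<in> bisupport C (\<partial>\<^bsub>B\<^esub> f)"
  then have "(i - 1, n) \<in> bisupport C f"
    using piece_d_zero[of i n] by (auto simp: bisupport_def bigraded_sum_simps)
  then show "(i, n) \<in> (\<lambda>p. (fst p + 1, snd p)) ` bisupport C f" by force
qed

lemma bigraded_sum_d_closed: "f \<in> carrier B \<Longrightarrow> \<partial>\<^bsub>B\<^esub> f \<in> carrier B"
  by (rule bigraded_sumI[OF _ _ bisupport_d])
    (auto simp: bigraded_sum_simps intro: linear_mapD(1)[OF piece_d_linear'])

lemma bigraded_sum_d_linear: "linear_map R B B \<partial>\<^bsub>B\<^esub>"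
  unfolding linear_map_def
proof (intro conjI ballI funcsetI ext bigraded_sum_d_closed)
  fix f g i n assume f: "f \<in> carrier B" and g: "g \<in> carrier B"
  show "(\<partial>\<^bsub>B\<^esub> (f \<oplus>\<^bsub>B\<^esub> g)) i n = (\<partial>\<^bsub>B\<^esub> f \<oplus>\<^bsub>B\<^esub> \<partial>\<^bsub>B\<^esub> g) i n"
    using linear_mapD(2)[OF piece_d_linear' bigraded_sumD(1)[OF f] bigraded_sumD(1)[OF g]]
    by (simp add: bigraded_sum_simps)
next
  fix c f i n assume c: "c \<in> carrier R" and f: "f \<in> carrier B"
  show "(\<partial>\<^bsub>B\<^esub> (c \<odot>\<^bsub>B\<^esub> f)) i n = (c \<odot>\<^bsub>B\<^esub> \<partial>\<^bsub>B\<^esub> f) i n"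
    using linear_mapD(3)[OF piece_d_linear' c bigraded_sumD(1)[OF f]]
    by (simp add: bigraded_sum_simps)
qed

lemma bigraded_sum_d_square:
  assumes f: "f \<in> carrier B"
  shows "\<partial>\<^bsub>B\<^esub> (\<partial>\<^bsub>B\<^esub> f) = \<zero>\<^bsub>B\<^esub>"
proof (intro ext)
  fix i n
  show "(\<partial>\<^bsub>B\<^esub> (\<partial>\<^bsub>B\<^esub> f)) i n = zero B i n"
    using piece_d_square[OF bigraded_sumD(1)[OF f], of "i - 1 - 1" n]
    by (simp add: bigraded_sum_simps)
qed

text \<open>The sign depends only on the degree of the first factor, which is constant over the support
  of an element of \<open>degree_part B i\<close>; so the Leibniz rule can be summed term by term.\<close>

lemma bigraded_sum_Leibniz:
  assumes f: "f \<in> degree_part B i" and g: "g \<in> carrier B"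
  shows "\<partial>\<^bsub>B\<^esub> (f \<otimes>\<^bsub>B\<^esub> g) = \<partial>\<^bsub>B\<^esub> f \<otimes>\<^bsub>B\<^esub> g \<oplus>\<^bsub>B\<^esub> koszul B i (f \<otimes>\<^bsub>B\<^esub> \<partial>\<^bsub>B\<^esub> g)"
proof (intro ext)
  fix k l
  have fB: "f \<in> carrier B" and "bisupport C f \<subseteq> fst -` {i}"
    using f by (simp_all add: graded_parts_supported(1) supported_part_def)
  then have deg: "fst p = i" if "p \<in> bisupport C f" for p
    using that by blast
  note fc = bigraded_sumD(1)[OF fB] and gc = bigraded_sumD(1)[OF g]
  note dfc = bigraded_sumD(1)[OF bigraded_sum_d_closed[OF fB]]
  note dgc = bigraded_sumD(1)[OF bigraded_sum_d_closed[OF g]]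
  interpret C: module R "C k l" by (rule piece_module)
  let ?S = "bisupport C f"
  let ?a = "\<lambda>p. \<partial>\<^bsub>C (fst p + 1) (snd p)\<^esub> (f (fst p) (snd p)) \<otimes>\<^bsub>C k l\<^esub> g (k - fst p - 1) (l - snd p)"
  let ?b = "\<lambda>p. f (fst p) (snd p) \<otimes>\<^bsub>C k l\<^esub> (\<partial>\<^bsub>B\<^esub> g) (k - fst p) (l - snd p)"
  have gc': "g (k - i - 1) n \<in> carrier (C (k - (i + 1)) n)" for i n
    using gc[of "k - (i + 1)" n] by (simp add: diff_diff_eq)
  have a: "?a p \<in> carrier (C k l)" for p
    by (intro piece_mult_closed[OF linear_mapD(1)[OF piece_d_linear fc] gc'])
  have b: "?b p \<in> carrier (C k l)" for p
    by (intro piece_mult_closed[OF fc dgc])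
  have kb: "koszul (C k l) i (?b p) \<in> carrier (C k l)" for p
    by (rule linear_mapD(1)[OF C.koszul_linear b])
  have "(\<partial>\<^bsub>B\<^esub> (f \<otimes>\<^bsub>B\<^esub> g)) k l =
      (\<Oplus>\<^bsub>C k l\<^esub>p\<in>?S. \<partial>\<^bsub>C k l\<^esub> (f (fst p) (snd p) \<otimes>\<^bsub>C (k - 1) l\<^esub> g (k - 1 - fst p) (l - snd p)))"
    unfolding bigraded_sum_simps(6) bigraded_sum_simps(2)
    by (rule linear_map_finsum[OF piece_d_linear' piece_module piece_module])
      (auto intro: piece_mult_closed[OF fc gc])
  also have "\<dots> = (\<Oplus>\<^bsub>C k l\<^esub>p\<in>?S. ?a p \<oplus>\<^bsub>C k l\<^esub> koszul (C k l) i (?b p))"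
  proof (rule C.finsum_cong'[OF refl])
    fix p assume p: "p \<in> ?S"
    have e: "k - 1 - fst p = k - fst p - 1" by simp
    show "\<partial>\<^bsub>C k l\<^esub> (f (fst p) (snd p) \<otimes>\<^bsub>C (k - 1) l\<^esub> g (k - 1 - fst p) (l - snd p))
        = ?a p \<oplus>\<^bsub>C k l\<^esub> koszul (C k l) i (?b p)"
      unfolding e using piece_Leibniz[OF fc gc, where i = "fst p" and n = "snd p" and k = k and l = l] deg[OF p]
      by (simp add: bigraded_sum_simps)
  qed (use a kb in auto)
  also have "\<dots> = (\<Oplus>\<^bsub>C k l\<^esub>p\<in>?S. ?a p) \<oplus>\<^bsub>C k l\<^esub> (\<Oplus>\<^bsub>C k l\<^esub>p\<in>?S. koszul (C k l) i (?b p))"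
    using a kb by (intro C.finsum_addf) auto
  also have "(\<Oplus>\<^bsub>C k l\<^esub>p\<in>?S. koszul (C k l) i (?b p)) = koszul (C k l) i ((f \<otimes>\<^bsub>B\<^esub> \<partial>\<^bsub>B\<^esub> g) k l)"
    unfolding bigraded_sum_simps(2)
    using b by (intro linear_map_finsum[OF C.koszul_linear piece_module piece_module, symmetric]) auto
  also have "(\<Oplus>\<^bsub>C k l\<^esub>p\<in>?S. ?a p) = (\<partial>\<^bsub>B\<^esub> f \<otimes>\<^bsub>B\<^esub> g) k l"
  proof -
    let ?sh = "\<lambda>p. (fst p + 1, snd p)"
    have "(\<partial>\<^bsub>B\<^esub> f \<otimes>\<^bsub>B\<^esub> g) k l = (\<Oplus>\<^bsub>C k l\<^esub>q\<in>?sh ` ?S.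
        (\<partial>\<^bsub>B\<^esub> f) (fst q) (snd q) \<otimes>\<^bsub>C k l\<^esub> g (k - fst q) (l - snd q))"
      by (rule bigraded_sum_mult_eq[OF bigraded_sum_d_closed[OF fB] g _ bisupport_d])
        (use bigraded_sumD(2)[OF fB] in auto)
    also have "\<dots> = (\<Oplus>\<^bsub>C k l\<^esub>p\<in>?S.
        (\<partial>\<^bsub>B\<^esub> f) (fst (?sh p)) (snd (?sh p)) \<otimes>\<^bsub>C k l\<^esub> g (k - fst (?sh p)) (l - snd (?sh p)))"
      by (rule C.finsum_reindex)
        (auto simp: inj_on_def prod_eq_iff intro!: piece_mult_closed[OF dfc gc])
    also have "\<dots> = (\<Oplus>\<^bsub>C k l\<^esub>p\<in>?S. ?a p)"
      by (simp add: bigraded_sum_simps(6) diff_diff_eq)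
    finally show ?thesis by simp
  qed
  finally show "(\<partial>\<^bsub>B\<^esub> (f \<otimes>\<^bsub>B\<^esub> g)) k l
      = (\<partial>\<^bsub>B\<^esub> f \<otimes>\<^bsub>B\<^esub> g \<oplus>\<^bsub>B\<^esub> koszul B i (f \<otimes>\<^bsub>B\<^esub> \<partial>\<^bsub>B\<^esub> g)) k l"
    by (simp add: bigraded_sum_simps(4)
        bigraded_sum_koszul[OF bigraded_sum_mult_closed[OF fB bigraded_sum_d_closed[OF g]]])
qed

lemma supported_part_mult:
  assumes "f \<in> supported_part C S" "g \<in> supported_part C T"
    and "\<And>p q. \<lbrakk>p \<in> S; q \<in> T\<rbrakk> \<Longrightarrow> (fst p + fst q, snd p + snd q) \<in> U"
  shows "f \<otimes>\<^bsub>B\<^esub> g \<in> supported_part C U"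
proof -
  have fg: "f \<in> carrier B" "g \<in> carrier B" "bisupport C f \<subseteq> S" "bisupport C g \<subseteq> T"
    using assms(1,2) by (simp_all add: supported_part_def)
  have "(\<lambda>(p, q). (fst p + fst q, snd p + snd q)) ` (bisupport C f \<times> bisupport C g) \<subseteq> U"
  proof (rule image_subsetI)
    fix pq assume "pq \<in> bisupport C f \<times> bisupport C g"
    then have "fst pq \<in> S" "snd pq \<in> T" using fg(3,4) by auto
    then show "(\<lambda>(p, q). (fst p + fst q, snd p + snd q)) pq \<in> U"
      using assms(3) by (simp add: case_prod_beta)
  qed
  then show ?thesis
    using bisupport_mult[OF fg(1,2)] bigraded_sum_mult_closed[OF fg(1,2)]
    by (simp add: supported_part_def)
qed

lemma supported_part_d:
  assumes "f \<in> supported_part C S" and "\<And>p. p \<in> S \<Longrightarrow> (fst p + 1, snd p) \<in> U"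
  shows "\<partial>\<^bsub>B\<^esub> f \<in> supported_part C U"
proof -
  have f: "f \<in> carrier B" "bisupport C f \<subseteq> S"
    using assms(1) by (simp_all add: supported_part_def)
  then have "(\<lambda>p. (fst p + 1, snd p)) ` bisupport C f \<subseteq> U"
    using assms(2) by blast
  then show ?thesis
    using bisupport_d[of f] bigraded_sum_d_closed[OF f(1)] by (simp add: supported_part_def)
qed

lemma bigraded_sum_dg_algebra: "dg_algebra R B"
proof (intro dg_algebra.intro dg_algebra_axioms.intro bigraded_sum_assoc_algebra
    bigraded_sum_d_linear bigraded_sum_d_square bigraded_sum_Leibniz)
  show "internal_grading R B (degree_part B)"
    using supported_part_grading[of UNIV fst]
    by (simp add: graded_parts_supported(1)[abs_def] graded_parts_supported(3)[symmetric])
  show "f \<otimes>\<^bsub>B\<^esub> g \<in> degree_part B (i + j)"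
    if "f \<in> degree_part B i" "g \<in> degree_part B j" for f g i j
    using that unfolding graded_parts_supported(1) by (rule supported_part_mult) auto
  show "\<partial>\<^bsub>B\<^esub> f \<in> degree_part B (i + 1)" if "f \<in> degree_part B i" for f i
    using that unfolding graded_parts_supported(1) by (rule supported_part_d) auto
qed

theorem bigraded_sum_weight_graded_dg_algebra: "weight_graded_dg_algebra R B"
proof (intro weight_graded_dg_algebra.intro weight_graded_dg_algebra_axioms.intro
    bigraded_sum_dg_algebra)
  show "internal_grading R B (weight_part B)"
    using supported_part_grading[of UNIV snd]
    by (simp add: graded_parts_supported(2)[abs_def] graded_parts_supported(3)[symmetric])
  show "internal_grading R (B\<lparr>carrier := weight_part B n\<rparr>) (\<lambda>i. weight_part B n \<inter> degree_part B i)"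
    for n
    using supported_part_grading[of "snd -` {n}" fst]
    by (simp add: graded_parts_supported(1,2) supported_part_Int)
  show "\<partial>\<^bsub>B\<^esub> f \<in> weight_part B n" if "f \<in> weight_part B n" for f n
    using that unfolding graded_parts_supported(2) by (rule supported_part_d) auto
  show "f \<otimes>\<^bsub>B\<^esub> g \<in> weight_part B (n + m)"
    if "f \<in> weight_part B n" "g \<in> weight_part B m" for f g n m
    using that unfolding graded_parts_supported(2) by (rule supported_part_mult) auto
qed

end

text \<open>An isomorphism may be given in each bidegree. Injectivity in each bidegree
  makes the supports of an element and of its image equal, so finite supports and all graded
  parts are preserved in both directions, and the convolution sums have the same index sets.\<close>

lemma bigraded_sum_isoI:
  fixes C :: "int \<Rightarrow> int \<Rightarrow> ('k, 'a, 'm) dmodule_scheme"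
    and D :: "int \<Rightarrow> int \<Rightarrow> ('k, 'b, 'n) dmodule_scheme"
  assumes C: "bigraded_dg_pieces R C" and D: "bigraded_dg_pieces R D"
    and bij: "\<And>i n. bij_betw (\<phi> i n) (carrier (C i n)) (carrier (D i n))"
    and lin: "\<And>i n. linear_map R (C i n) (D i n) (\<phi> i n)"
    and d: "\<And>i n x. x \<in> carrier (C i n) \<Longrightarrow>
      \<phi> (i + 1) n (\<partial>\<^bsub>C (i + 1) n\<^esub> x) = \<partial>\<^bsub>D (i + 1) n\<^esub> (\<phi> i n x)"
    and mult: "\<And>i n k l x y. \<lbrakk>x \<in> carrier (C i n); y \<in> carrier (C (k - i) (l - n))\<rbrakk> \<Longrightarrow>
      \<phi> k l (x \<otimes>\<^bsub>C k l\<^esub> y) = \<phi> i n x \<otimes>\<^bsub>D k l\<^esub> \<phi> (k - i) (l - n) y"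
  shows "weight_graded_dg_iso R (bigraded_sum C) (bigraded_sum D) (\<lambda>f i n. \<phi> i n (f i n))"
proof -
  interpret C: bigraded_dg_pieces R C by (rule C)
  interpret D: bigraded_dg_pieces R D by (rule D)
  let ?\<Phi> = "\<lambda>f i n. \<phi> i n (f i n)"
  have zero: "\<phi> i n x = \<zero>\<^bsub>D i n\<^esub> \<longleftrightarrow> x = \<zero>\<^bsub>C i n\<^esub>" if "x \<in> carrier (C i n)" for i n x
    using linear_map_zero[OF lin C.piece_module D.piece_module, of i n]
      inj_on_eq_iff[OF bij_betw_imp_inj_on[OF bij] that C.piece_zero_closed] by simp
  have supp: "bisupport D (?\<Phi> f) = bisupport C f" if "\<And>i n. f i n \<in> carrier (C i n)" for f
    using zero that by (simp add: bisupport_def)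
  have into: "?\<Phi> f \<in> supported_part D T" if "f \<in> supported_part C T" for f T
    using that supp[of f] linear_mapD(1)[OF lin]
    by (simp add: supported_part_def bigraded_sum_simps(1))
  have onto: "\<exists>f\<in>supported_part C T. ?\<Phi> f = g" if g: "g \<in> supported_part D T" for g T
  proof -
    define f where "f i n = inv_into (carrier (C i n)) (\<phi> i n) (g i n)" for i n
    have gc: "g i n \<in> \<phi> i n ` carrier (C i n)" for i n
      using g bij_betw_imp_surj_on[OF bij, of i n] by (simp add: supported_part_def bigraded_sum_simps(1))
    have fc: "f i n \<in> carrier (C i n)" for i n
      unfolding f_def by (rule inv_into_into[OF gc])
    have eq: "?\<Phi> f = g"
      unfolding f_def by (intro ext) (rule f_inv_into_f[OF gc])
    then have "bisupport C f = bisupport D g" using supp[OF fc] by simp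
    then have "f \<in> supported_part C T"
      using g fc by (simp add: supported_part_def bigraded_sum_simps(1))
    with eq show ?thesis by blast
  qed
  have img: "?\<Phi> ` supported_part C T = supported_part D T" for T
    using into[of _ T] onto[of _ T] by blast
  have inj: "inj_on ?\<Phi> (supported_part C UNIV)"
  proof (rule inj_onI, intro ext)
    fix f g i n
    assume fg: "f \<in> supported_part C UNIV" "g \<in> supported_part C UNIV" and eq: "?\<Phi> f = ?\<Phi> g"
    show "f i n = g i n"
      using inj_onD[OF bij_betw_imp_inj_on[OF bij] fun_cong[OF fun_cong[OF eq]]] fg
      by (simp add: supported_part_def bigraded_sum_simps(1))
  qed
  show ?thesis
    unfolding weight_graded_dg_iso_def graded_parts_supported
  proof (intro conjI allI ballI img)
    show "bij_betw ?\<Phi> (supported_part C UNIV) (supported_part D UNIV)"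
      using inj img by (simp add: bij_betw_def)
    show "linear_map R (bigraded_sum C) (bigraded_sum D) ?\<Phi>"
      using into[of _ UNIV] linear_mapD(2,3)[OF lin] C.bigraded_sumD(1)
      by (auto simp: linear_map_def fun_eq_iff bigraded_sum_simps(4,5) graded_parts_supported(3)[symmetric])
  next
    fix f assume "f \<in> supported_part C UNIV"
    then have f: "f \<in> carrier (bigraded_sum C)" by (simp add: graded_parts_supported)
    note fc = C.bigraded_sumD(1)[OF f]
    show "?\<Phi> (\<partial>\<^bsub>bigraded_sum C\<^esub> f) = \<partial>\<^bsub>bigraded_sum D\<^esub> (?\<Phi> f)"
      using d[OF fc, of "_ - 1"] by (simp add: fun_eq_iff bigraded_sum_simps)
    fix g assume "g \<in> supported_part C UNIV"
    then have g: "g \<in> carrier (bigraded_sum C)" by (simp add: graded_parts_supported)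
    note gc = C.bigraded_sumD(1)[OF g]
    show "?\<Phi> (f \<otimes>\<^bsub>bigraded_sum C\<^esub> g) = ?\<Phi> f \<otimes>\<^bsub>bigraded_sum D\<^esub> ?\<Phi> g"
    proof (intro ext)
      fix k l
      interpret D': module R "D k l" by (rule D.piece_module)
      have "\<phi> k l ((f \<otimes>\<^bsub>bigraded_sum C\<^esub> g) k l) = (\<Oplus>\<^bsub>D k l\<^esub>p\<in>bisupport C f.
          \<phi> k l (f (fst p) (snd p) \<otimes>\<^bsub>C k l\<^esub> g (k - fst p) (l - snd p)))"
        unfolding bigraded_sum_simps(2)
        by (rule linear_map_finsum[OF lin C.piece_module D.piece_module])
          (auto intro: C.piece_mult_closed[OF fc gc])
      also have "\<dots> = (?\<Phi> f \<otimes>\<^bsub>bigraded_sum D\<^esub> ?\<Phi> g) k l"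
        unfolding bigraded_sum_simps(2) supp[OF fc] by (simp add: mult[OF fc gc])
      finally show "?\<Phi> (f \<otimes>\<^bsub>bigraded_sum C\<^esub> g) k l = (?\<Phi> f \<otimes>\<^bsub>bigraded_sum D\<^esub> ?\<Phi> g) k l" .
    qed
  qed
qed

section \<open>Associated graded modules\<close>

definition gr_class :: "('k, 'a, 'm) module_scheme \<Rightarrow> (int \<Rightarrow> 'a set) \<Rightarrow> int \<Rightarrow> 'a \<Rightarrow> 'a set"
  where "gr_class M P n x = P (n - 1) +>\<^bsub>M\<^esub> x"

locale filtered_module = module R M
  for R :: "('k, 'r) ring_scheme" (structure) and M :: "('k, 'a, 'm) dmodule_scheme" (structure) +
  fixes P :: "int \<Rightarrow> 'a set"
  assumes submod: "submodule (P n) R M"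
begin

lemma abelian_subgroup_level: "abelian_subgroup (P n) M"
  using submodule.axioms(1)[OF submod]
  by (intro abelian_subgroupI3 additive_subgroup.intro M.abelian_group_axioms)

lemma level_carrier: "x \<in> P n \<Longrightarrow> x \<in> carrier M"
  using submoduleE(1)[OF submod] by blast

lemma level_add: "\<lbrakk>x \<in> P n; y \<in> P n\<rbrakk> \<Longrightarrow> x \<oplus>\<^bsub>M\<^esub> y \<in> P n"
  using submoduleE(5)[OF submod] by blast

lemma gr_class_eq_iff:
  assumes "x \<in> carrier M" "y \<in> carrier M"
  shows "gr_class M P n x = gr_class M P n y \<longleftrightarrow> x \<ominus>\<^bsub>M\<^esub> y \<in> P (n - 1)"
proof -
  interpret H: abelian_subgroup "P (n - 1)" M by (rule abelian_subgroup_level)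
  show ?thesis
    using H.a_repr_independence'[of x y] H.a_repr_independenceD[of x y] H.a_rcos_module[of y x] assms
    unfolding gr_class_def a_minus_def by metis
qed

lemma gr_class_absorb:
  assumes "u \<in> P (n - 1)" "x \<in> carrier M"
  shows "gr_class M P n (u \<oplus>\<^bsub>M\<^esub> x) = gr_class M P n x"
proof -
  interpret H: abelian_subgroup "P (n - 1)" M by (rule abelian_subgroup_level)
  show ?thesis
    using H.a_repr_independence'[of "u \<oplus>\<^bsub>M\<^esub> x" x] M.a_rcosI[OF assms(1) H.a_subset assms(2)] assms(2)
    by (simp add: gr_class_def)
qed

lemma mem_gr_class_iff: "y \<in> gr_class M P n x \<longleftrightarrow> (\<exists>u\<in>P (n - 1). y = u \<oplus>\<^bsub>M\<^esub> x)"
  by (auto simp: gr_class_def a_r_coset_def')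

lemma gr_class_nonempty: "gr_class M P n x \<noteq> {}"
  using submoduleE(2)[OF submod] by (auto simp: gr_class_def a_r_coset_def')

lemma gr_part_zero: "\<zero>\<^bsub>gr_part M P n\<^esub> = gr_class M P n \<zero>\<^bsub>M\<^esub>"
  using submoduleE(1)[OF submod] by (simp add: gr_part_def gr_class_def)

lemma gr_part_add:
  assumes "x \<in> carrier M" "y \<in> carrier M"
  shows "gr_class M P n x \<oplus>\<^bsub>gr_part M P n\<^esub> gr_class M P n y = gr_class M P n (x \<oplus>\<^bsub>M\<^esub> y)"
  using abelian_subgroup.a_rcos_sum[OF abelian_subgroup_level assms]
  by (simp add: gr_part_def gr_class_def)

lemma gr_part_smult:
  assumes "c \<in> carrier R" "x \<in> carrier M"
  shows "c \<odot>\<^bsub>gr_part M P n\<^esub> gr_class M P n x = gr_class M P n (c \<odot>\<^bsub>M\<^esub> x)"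
proof -
  have "gr_class M P n (c \<odot>\<^bsub>M\<^esub> y) = gr_class M P n (c \<odot>\<^bsub>M\<^esub> x)" if y: "y \<in> gr_class M P n x" for y
  proof -
    from y obtain u where u: "u \<in> P (n - 1)" and y_eq: "y = u \<oplus>\<^bsub>M\<^esub> x"
      unfolding mem_gr_class_iff by blast
    have "c \<odot>\<^bsub>M\<^esub> y = c \<odot>\<^bsub>M\<^esub> u \<oplus>\<^bsub>M\<^esub> c \<odot>\<^bsub>M\<^esub> x"
      unfolding y_eq by (rule smult_r_distr[OF assms(1) level_carrier[OF u] assms(2)])
    then show ?thesis
      using gr_class_absorb[OF submoduleE(4)[OF submod assms(1) u] smult_closed[OF assms]] by simp
  qed
  then have "(\<Union>y\<in>gr_class M P n x. gr_class M P n (c \<odot>\<^bsub>M\<^esub> y)) = gr_class M P n (c \<odot>\<^bsub>M\<^esub> x)"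
    using gr_class_nonempty by simp
  then show ?thesis by (simp add: gr_part_def gr_class_def)
qed

lemma gr_part_carrier: "carrier (gr_part M P n) = gr_class M P n ` P n"
  by (simp add: gr_part_def gr_class_def image_def)

text \<open>For \<open>H = P n\<close> this is the whole of \<open>gr_part M P n\<close>; for smaller \<open>H\<close> it shows that the induced
  filtration consists of submodules.\<close>

lemma gr_image_module:
  assumes "submodule H R M"
  shows "module R (gr_part M P n\<lparr>carrier := gr_class M P n ` H\<rparr>)"
proof (rule module_imageI[OF module_axioms assms, where f = "gr_class M P n"])
  note c = subsetD[OF submoduleE(1)[OF assms]]
  show "gr_class M P n x \<oplus>\<^bsub>gr_part M P n\<lparr>carrier := gr_class M P n ` H\<rparr>\<^esub> gr_class M P n y
    = gr_class M P n (x \<oplus>\<^bsub>M\<^esub> y)" if "x \<in> H" "y \<in> H" for x y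
    using gr_part_add[OF c[OF that(1)] c[OF that(2)]] by simp
  show "a \<odot>\<^bsub>gr_part M P n\<lparr>carrier := gr_class M P n ` H\<rparr>\<^esub> gr_class M P n x
    = gr_class M P n (a \<odot>\<^bsub>M\<^esub> x)" if "a \<in> carrier R" "x \<in> H" for a x
    using gr_part_smult[OF that(1) c[OF that(2)]] by simp
qed (simp_all add: gr_part_zero)

lemma gr_part_module: "module R (gr_part M P n)"
  using gr_image_module[OF submod, of n n] by (simp add: gr_part_carrier[symmetric])

text \<open>The multiplication and the differential of \<open>gr_part M P n\<close> are unions over all
  representatives, so they are computed by a class that does not depend on the representative.
  The arguments are classes of arbitrary other quotients, since they come from different parts.\<close>

lemma gr_part_multI:
  assumes "\<And>y y'. \<lbrakk>y \<in> gr_class L S i x; y' \<in> gr_class L' S' j x'\<rbrakk> \<Longrightarrow> gr_class M P n (y \<otimes>\<^bsub>M\<^esub> y') = Z"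
    and "gr_class L S i x \<noteq> {}" "gr_class L' S' j x' \<noteq> {}"
  shows "gr_class L S i x \<otimes>\<^bsub>gr_part M P n\<^esub> gr_class L' S' j x' = Z"
  using assms by (simp add: gr_part_def gr_class_def)

lemma gr_part_dI:
  assumes "\<And>y. y \<in> gr_class L S i x \<Longrightarrow> gr_class M P n (\<partial>\<^bsub>M\<^esub> y) = Z" and "gr_class L S i x \<noteq> {}"
  shows "\<partial>\<^bsub>gr_part M P n\<^esub> (gr_class L S i x) = Z"
  using assms by (simp add: gr_part_def gr_class_def)

end

section \<open>Two filtrations\<close>

text \<open>The differential raises \<open>P\<close> by \<open>p\<close> and \<open>Q\<close> by \<open>q\<close>. With these parameters the roles
  of the two filtrations can be exchanged, although the differential has degree 1 for one of
  them and weight 0 for the other.\<close>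

locale two_filtrations = assoc_algebra R A
  for R :: "('k, 'r) ring_scheme" (structure) and A :: "('k, 'a, 'm) dmodule_scheme" (structure) +
  fixes P Q :: "int \<Rightarrow> 'a set" and p q :: int
  assumes P_submodule: "submodule (P n) R A" and Q_submodule: "submodule (Q i) R A"
    and P_mono: "P n \<subseteq> P (n + 1)" and Q_mono: "Q i \<subseteq> Q (i + 1)"
    and P_mult: "\<lbrakk>x \<in> P n; y \<in> P m\<rbrakk> \<Longrightarrow> x \<otimes>\<^bsub>A\<^esub> y \<in> P (n + m)"
    and Q_mult: "\<lbrakk>x \<in> Q i; y \<in> Q j\<rbrakk> \<Longrightarrow> x \<otimes>\<^bsub>A\<^esub> y \<in> Q (i + j)"
    and dA_linear: "linear_map R A A \<partial>\<^bsub>A\<^esub>"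
    and P_d: "x \<in> P n \<Longrightarrow> \<partial>\<^bsub>A\<^esub> x \<in> P (n + p)"
    and Q_d: "x \<in> Q i \<Longrightarrow> \<partial>\<^bsub>A\<^esub> x \<in> Q (i + q)"
begin

abbreviation gr where "gr n \<equiv> gr_part A P n"
abbreviation G where "G n \<equiv> gr_filtration A P Q n"
abbreviation cls where "cls \<equiv> gr_class A P"

text \<open>Index \<open>n\<close> belongs to \<open>P\<close>, whose associated graded object is taken first, and \<open>i\<close> to \<open>Q\<close>.\<close>

definition gr_gr_class :: "int \<Rightarrow> int \<Rightarrow> 'a \<Rightarrow> 'a set set"
  where "gr_gr_class n i x = gr_class (gr n) (G n) i (cls n x)"

sublocale P: filtered_module R A P
  by (intro filtered_module.intro module_axioms filtered_module_axioms.intro P_submodule)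

lemma QP_submodule: "submodule (Q i \<inter> P n) R A"
  by (rule submodule_Int[OF Q_submodule P_submodule])

lemma G_eq: "G n i = cls n ` (Q i \<inter> P n)"
  by (simp add: gr_filtration_def gr_class_def image_def)

lemma filtered_module_gr: "filtered_module R (gr n) (G n)"
proof (intro filtered_module.intro P.gr_part_module filtered_module_axioms.intro)
  fix i
  interpret gr: module R "gr n" by (rule P.gr_part_module)
  show "submodule (G n i) R (gr n)"
  proof (rule gr.module_incl_imp_submodule)
    show "G n i \<subseteq> carrier (gr n)" by (auto simp: G_eq P.gr_part_carrier)
    show "module R (gr n\<lparr>carrier := G n i\<rparr>)"
      unfolding G_eq by (rule P.gr_image_module[OF QP_submodule])
  qed
qed

lemma cls_closed: "x \<in> P n \<Longrightarrow> cls n x \<in> carrier (gr n)"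
  by (simp add: P.gr_part_carrier)

lemma gr_gr_carrier: "carrier (gr_part (gr n) (G n) i) = gr_gr_class n i ` (Q i \<inter> P n)"
proof -
  interpret G: filtered_module R "gr n" "G n" by (rule filtered_module_gr)
  show ?thesis unfolding G.gr_part_carrier by (simp add: G_eq gr_gr_class_def image_image)
qed

lemma gr_gr_zero: "\<zero>\<^bsub>gr_part (gr n) (G n) i\<^esub> = gr_gr_class n i \<zero>\<^bsub>A\<^esub>"
proof -
  interpret G: filtered_module R "gr n" "G n" by (rule filtered_module_gr)
  show ?thesis by (simp add: G.gr_part_zero gr_gr_class_def P.gr_part_zero)
qed

lemma gr_gr_add:
  assumes "x \<in> P n" "y \<in> P n"
  shows "gr_gr_class n i x \<oplus>\<^bsub>gr_part (gr n) (G n) i\<^esub> gr_gr_class n i y = gr_gr_class n i (x \<oplus>\<^bsub>A\<^esub> y)"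
proof -
  interpret G: filtered_module R "gr n" "G n" by (rule filtered_module_gr)
  show ?thesis
    unfolding gr_gr_class_def G.gr_part_add[OF cls_closed[OF assms(1)] cls_closed[OF assms(2)]]
    by (simp add: P.gr_part_add P.level_carrier[OF assms(1)] P.level_carrier[OF assms(2)])
qed

lemma gr_gr_smult:
  assumes "c \<in> carrier R" "x \<in> P n"
  shows "c \<odot>\<^bsub>gr_part (gr n) (G n) i\<^esub> gr_gr_class n i x = gr_gr_class n i (c \<odot>\<^bsub>A\<^esub> x)"
proof -
  interpret G: filtered_module R "gr n" "G n" by (rule filtered_module_gr)
  show ?thesis
    unfolding gr_gr_class_def G.gr_part_smult[OF assms(1) cls_closed[OF assms(2)]]
    by (simp add: P.gr_part_smult assms(1) P.level_carrier[OF assms(2)])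
qed

text \<open>The first summand on the right is the effect of perturbing \<open>x\<close> and \<open>y\<close> by
  elements \<open>u\<close> and \<open>v\<close> of lower filtration. The identity serves at both levels: for the cosets of \<open>P\<close> with
  \<open>u, v\<close> lower for \<open>P\<close>, and for the cosets of the induced filtration with \<open>u, v\<close> lower for \<open>Q\<close>.\<close>

lemma mult_perturbed:
  assumes "u \<in> carrier A" "x \<in> carrier A" "v \<in> carrier A" "y \<in> carrier A"
  shows "(u \<oplus>\<^bsub>A\<^esub> x) \<otimes>\<^bsub>A\<^esub> (v \<oplus>\<^bsub>A\<^esub> y) = (u \<otimes>\<^bsub>A\<^esub> (v \<oplus>\<^bsub>A\<^esub> y) \<oplus>\<^bsub>A\<^esub> x \<otimes>\<^bsub>A\<^esub> v) \<oplus>\<^bsub>A\<^esub> x \<otimes>\<^bsub>A\<^esub> y"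
proof -
  have vy: "v \<oplus>\<^bsub>A\<^esub> y \<in> carrier A" using assms by blast
  show ?thesis
    unfolding linear_mapD(2)[OF mult_linear_left[OF vy] assms(1,2)]
      linear_mapD(2)[OF mult_linear_right[OF assms(2)] assms(3,4)]
    by (rule M.a_assoc[symmetric]) (intro mult_closed assms vy)+
qed

lemma filtered_perturbation:
  fixes S :: "int \<Rightarrow> 'a set"
  assumes S: "\<And>k. submodule (S k) R A" and S_mono: "\<And>k. S k \<subseteq> S (k + 1)"
    and S_mult: "\<And>x y k l. \<lbrakk>x \<in> S k; y \<in> S l\<rbrakk> \<Longrightarrow> x \<otimes>\<^bsub>A\<^esub> y \<in> S (k + l)"
    and "u \<in> S (i - 1)" "x \<in> S i" "v \<in> S (j - 1)" "y \<in> S j"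
  shows "u \<otimes>\<^bsub>A\<^esub> (v \<oplus>\<^bsub>A\<^esub> y) \<oplus>\<^bsub>A\<^esub> x \<otimes>\<^bsub>A\<^esub> v \<in> S (i + j - 1)"
proof -
  have "v \<in> S j" using S_mono[of "j - 1"] assms(6) by auto
  then have "v \<oplus>\<^bsub>A\<^esub> y \<in> S j" using submoduleE(5)[OF S] assms(7) by blast
  then have "u \<otimes>\<^bsub>A\<^esub> (v \<oplus>\<^bsub>A\<^esub> y) \<in> S (i + j - 1)"
    using S_mult[OF assms(4)] by (metis diff_add_eq)
  moreover have "x \<otimes>\<^bsub>A\<^esub> v \<in> S (i + j - 1)"
    using S_mult[OF assms(5,6)] by (metis add_diff_eq)
  ultimately show ?thesis using submoduleE(5)[OF S] by blast
qed

lemma gr_mult: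
  assumes x: "x \<in> P n" and y: "y \<in> P m"
  shows "cls n x \<otimes>\<^bsub>gr (n + m)\<^esub> cls m y = cls (n + m) (x \<otimes>\<^bsub>A\<^esub> y)"
proof (rule P.gr_part_multI)
  fix x' y' assume "x' \<in> cls n x" "y' \<in> cls m y"
  then obtain u v where uv: "u \<in> P (n - 1)" "v \<in> P (m - 1)"
    and eq: "x' = u \<oplus>\<^bsub>A\<^esub> x" "y' = v \<oplus>\<^bsub>A\<^esub> y"
    unfolding P.mem_gr_class_iff by blast
  note c = P.level_carrier
  show "cls (n + m) (x' \<otimes>\<^bsub>A\<^esub> y') = cls (n + m) (x \<otimes>\<^bsub>A\<^esub> y)"
    unfolding eq mult_perturbed[OF c[OF uv(1)] c[OF x] c[OF uv(2)] c[OF y]]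
    by (intro P.gr_class_absorb filtered_perturbation P_submodule P_mono P_mult uv x y
        mult_closed c[OF x] c[OF y])
qed (rule P.gr_class_nonempty)+

lemma gr_d:
  assumes x: "x \<in> P n"
  shows "\<partial>\<^bsub>gr (n + p)\<^esub> (cls n x) = cls (n + p) (\<partial>\<^bsub>A\<^esub> x)"
proof (rule P.gr_part_dI)
  fix x' assume "x' \<in> cls n x"
  then obtain u where u: "u \<in> P (n - 1)" and eq: "x' = u \<oplus>\<^bsub>A\<^esub> x"
    unfolding P.mem_gr_class_iff by blast
  have "\<partial>\<^bsub>A\<^esub> u \<in> P (n + p - 1)" using P_d[OF u] by (simp add: algebra_simps)
  then show "cls (n + p) (\<partial>\<^bsub>A\<^esub> x') = cls (n + p) (\<partial>\<^bsub>A\<^esub> x)"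
    unfolding eq linear_mapD(2)[OF dA_linear P.level_carrier[OF u] P.level_carrier[OF x]]
    by (intro P.gr_class_absorb linear_mapD(1)[OF dA_linear] P.level_carrier[OF x])
qed (rule P.gr_class_nonempty)

lemma mem_gr_gr_classE:
  assumes "X \<in> gr_gr_class n i x" "x \<in> P n"
  obtains u where "u \<in> Q (i - 1)" "u \<in> P n" "X = cls n (u \<oplus>\<^bsub>A\<^esub> x)"
proof -
  interpret G: filtered_module R "gr n" "G n" by (rule filtered_module_gr)
  obtain u where u: "u \<in> Q (i - 1) \<inter> P n" "X = cls n u \<oplus>\<^bsub>gr n\<^esub> cls n x"
    using assms(1) unfolding gr_gr_class_def G.mem_gr_class_iff G_eq by blast
  then have "X = cls n (u \<oplus>\<^bsub>A\<^esub> x)"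
    using P.gr_part_add[OF P.level_carrier P.level_carrier[OF assms(2)], of u n] by simp
  then show thesis using that[of u] u(1) by blast
qed

lemma gr_gr_class_absorb:
  assumes "w \<in> Q (i - 1)" "w \<in> P n" "z \<in> P n"
  shows "gr_class (gr n) (G n) i (cls n (w \<oplus>\<^bsub>A\<^esub> z)) = gr_gr_class n i z"
proof -
  interpret G: filtered_module R "gr n" "G n" by (rule filtered_module_gr)
  have "cls n w \<in> G n (i - 1)" unfolding G_eq using assms by blast
  from G.gr_class_absorb[OF this cls_closed[OF assms(3)]] show ?thesis
    unfolding gr_gr_class_def
      P.gr_part_add[OF P.level_carrier[OF assms(2)] P.level_carrier[OF assms(3)]] .
qed

lemma gr_gr_class_nonempty: "gr_gr_class n i x \<noteq> {}"
  unfolding gr_gr_class_def by (rule filtered_module.gr_class_nonempty[OF filtered_module_gr])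

lemma gr_gr_mult:
  assumes x: "x \<in> Q i" "x \<in> P n" and y: "y \<in> Q j" "y \<in> P m"
  shows "gr_gr_class n i x \<otimes>\<^bsub>gr_part (gr (n + m)) (G (n + m)) (i + j)\<^esub> gr_gr_class m j y
    = gr_gr_class (n + m) (i + j) (x \<otimes>\<^bsub>A\<^esub> y)"
proof -
  interpret G: filtered_module R "gr (n + m)" "G (n + m)" by (rule filtered_module_gr)
  note c = P.level_carrier
  have "gr_class (gr (n + m)) (G (n + m)) (i + j) (X \<otimes>\<^bsub>gr (n + m)\<^esub> Y)
      = gr_gr_class (n + m) (i + j) (x \<otimes>\<^bsub>A\<^esub> y)"
    if X: "X \<in> gr_gr_class n i x" and Y: "Y \<in> gr_gr_class m j y" for X Y
  proof -
    obtain u where u: "u \<in> Q (i - 1)" "u \<in> P n" and X_eq: "X = cls n (u \<oplus>\<^bsub>A\<^esub> x)"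
      using mem_gr_gr_classE[OF X x(2)] .
    obtain v where v: "v \<in> Q (j - 1)" "v \<in> P m" and Y_eq: "Y = cls m (v \<oplus>\<^bsub>A\<^esub> y)"
      using mem_gr_gr_classE[OF Y y(2)] .
    have "X \<otimes>\<^bsub>gr (n + m)\<^esub> Y = cls (n + m) ((u \<oplus>\<^bsub>A\<^esub> x) \<otimes>\<^bsub>A\<^esub> (v \<oplus>\<^bsub>A\<^esub> y))"
      unfolding X_eq Y_eq by (intro gr_mult P.level_add u v x y)
    also have "(u \<oplus>\<^bsub>A\<^esub> x) \<otimes>\<^bsub>A\<^esub> (v \<oplus>\<^bsub>A\<^esub> y)
        = (u \<otimes>\<^bsub>A\<^esub> (v \<oplus>\<^bsub>A\<^esub> y) \<oplus>\<^bsub>A\<^esub> x \<otimes>\<^bsub>A\<^esub> v) \<oplus>\<^bsub>A\<^esub> x \<otimes>\<^bsub>A\<^esub> y"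
      by (intro mult_perturbed c[OF u(2)] c[OF v(2)] c[OF x(2)] c[OF y(2)])
    finally show ?thesis
      by (simp only:) (intro gr_gr_class_absorb filtered_perturbation Q_submodule Q_mono Q_mult
          P.level_add P_mult u v x y)
  qed
  then show ?thesis
    unfolding gr_gr_class_def[of n] gr_gr_class_def[of m]
    using gr_gr_class_nonempty[unfolded gr_gr_class_def] by (intro G.gr_part_multI) auto
qed

lemma gr_gr_d:
  assumes x: "x \<in> Q i" "x \<in> P n"
  shows "\<partial>\<^bsub>gr_part (gr (n + p)) (G (n + p)) (i + q)\<^esub> (gr_gr_class n i x)
    = gr_gr_class (n + p) (i + q) (\<partial>\<^bsub>A\<^esub> x)"
proof -
  interpret G: filtered_module R "gr (n + p)" "G (n + p)" by (rule filtered_module_gr)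
  have "gr_class (gr (n + p)) (G (n + p)) (i + q) (\<partial>\<^bsub>gr (n + p)\<^esub> X)
      = gr_gr_class (n + p) (i + q) (\<partial>\<^bsub>A\<^esub> x)"
    if X: "X \<in> gr_gr_class n i x" for X
  proof -
    obtain u where u: "u \<in> Q (i - 1)" "u \<in> P n" and X_eq: "X = cls n (u \<oplus>\<^bsub>A\<^esub> x)"
      using mem_gr_gr_classE[OF X x(2)] .
    have "\<partial>\<^bsub>gr (n + p)\<^esub> X = cls (n + p) (\<partial>\<^bsub>A\<^esub> (u \<oplus>\<^bsub>A\<^esub> x))"
      unfolding X_eq by (intro gr_d P.level_add u x)
    also have "\<partial>\<^bsub>A\<^esub> (u \<oplus>\<^bsub>A\<^esub> x) = \<partial>\<^bsub>A\<^esub> u \<oplus>\<^bsub>A\<^esub> \<partial>\<^bsub>A\<^esub> x"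
      by (rule linear_mapD(2)[OF dA_linear P.level_carrier[OF u(2)] P.level_carrier[OF x(2)]])
    finally have "\<partial>\<^bsub>gr (n + p)\<^esub> X = cls (n + p) (\<partial>\<^bsub>A\<^esub> u \<oplus>\<^bsub>A\<^esub> \<partial>\<^bsub>A\<^esub> x)" .
    moreover have "\<partial>\<^bsub>A\<^esub> u \<in> Q (i + q - 1)" using Q_d[OF u(1)] by (simp add: algebra_simps)
    ultimately show ?thesis
      using gr_gr_class_absorb P_d[OF u(2)] P_d[OF x(2)] by simp
  qed
  then show ?thesis
    unfolding gr_gr_class_def[of n]
    using gr_gr_class_nonempty[unfolded gr_gr_class_def] by (intro G.gr_part_dI) auto
qed

text \<open>The class of \<open>z = x - y\<close> vanishes if and only if some \<open>u\<close> in \<open>Q (i - 1) \<inter> P n\<close> has the same class as \<open>z\<close>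
  modulo \<open>P (n - 1)\<close>. Then \<open>z - u\<close> lies in \<open>P (n - 1)\<close>, but also in \<open>Q i\<close>, because \<open>z\<close> and \<open>u\<close>
  do. This is the modular law, and it makes the kernel symmetric in \<open>P\<close> and \<open>Q\<close>.\<close>

lemma gr_gr_class_eq_iff:
  assumes x: "x \<in> Q i" "x \<in> P n" and y: "y \<in> Q i" "y \<in> P n"
  shows "gr_gr_class n i x = gr_gr_class n i y \<longleftrightarrow>
    x \<ominus>\<^bsub>A\<^esub> y \<in> (Q (i - 1) \<inter> P n) <+>\<^bsub>A\<^esub> (Q i \<inter> P (n - 1))"
proof -
  interpret G: filtered_module R "gr n" "G n" by (rule filtered_module_gr)
  note c = P.level_carrier
  have d: "x \<ominus>\<^bsub>A\<^esub> y \<in> Q i" "x \<ominus>\<^bsub>A\<^esub> y \<in> P n"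
    using x y submoduleE(3,5)[OF Q_submodule] submoduleE(3,5)[OF P_submodule]
    by (auto simp: a_minus_def)
  have "cls n (x \<ominus>\<^bsub>A\<^esub> y) = cls n x \<ominus>\<^bsub>gr n\<^esub> cls n y"
  proof -
    have "cls n y \<oplus>\<^bsub>gr n\<^esub> cls n (x \<ominus>\<^bsub>A\<^esub> y) = cls n x"
      unfolding P.gr_part_add[OF c[OF y(2)] c[OF d(2)]]
        M.add_minus_cancel'[OF c[OF y(2)] c[OF x(2)]] ..
    then show ?thesis
      using G.M.add_minus_cancel[OF cls_closed[OF y(2)] cls_closed[OF d(2)]] by simp
  qed
  then have "gr_gr_class n i x = gr_gr_class n i y \<longleftrightarrow> cls n (x \<ominus>\<^bsub>A\<^esub> y) \<in> G n (i - 1)"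
    unfolding gr_gr_class_def
    using G.gr_class_eq_iff[OF cls_closed[OF x(2)] cls_closed[OF y(2)]] by simp
  also have "\<dots> \<longleftrightarrow> (\<exists>u\<in>Q (i - 1) \<inter> P n. (x \<ominus>\<^bsub>A\<^esub> y) \<ominus>\<^bsub>A\<^esub> u \<in> P (n - 1))"
  proof -
    have "cls n (x \<ominus>\<^bsub>A\<^esub> y) = cls n u \<longleftrightarrow> (x \<ominus>\<^bsub>A\<^esub> y) \<ominus>\<^bsub>A\<^esub> u \<in> P (n - 1)" if "u \<in> P n" for u
      by (rule P.gr_class_eq_iff[OF c[OF d(2)] c[OF that]])
    then show ?thesis unfolding G_eq image_iff by blast
  qed
  also have "\<dots> \<longleftrightarrow> x \<ominus>\<^bsub>A\<^esub> y \<in> (Q (i - 1) \<inter> P n) <+>\<^bsub>A\<^esub> (Q i \<inter> P (n - 1))"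
  proof
    assume "\<exists>u\<in>Q (i - 1) \<inter> P n. (x \<ominus>\<^bsub>A\<^esub> y) \<ominus>\<^bsub>A\<^esub> u \<in> P (n - 1)"
    then obtain u where u: "u \<in> Q (i - 1)" "u \<in> P n" "(x \<ominus>\<^bsub>A\<^esub> y) \<ominus>\<^bsub>A\<^esub> u \<in> P (n - 1)" by blast
    have "u \<in> Q i" using Q_mono[of "i - 1"] u(1) by auto
    then have "(x \<ominus>\<^bsub>A\<^esub> y) \<ominus>\<^bsub>A\<^esub> u \<in> Q i"
      using d(1) submoduleE(3,5)[OF Q_submodule] by (simp add: a_minus_def)
    moreover have "x \<ominus>\<^bsub>A\<^esub> y = u \<oplus>\<^bsub>A\<^esub> ((x \<ominus>\<^bsub>A\<^esub> y) \<ominus>\<^bsub>A\<^esub> u)"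
      by (rule M.add_minus_cancel'[OF c[OF u(2)] c[OF d(2)], symmetric])
    ultimately show "x \<ominus>\<^bsub>A\<^esub> y \<in> (Q (i - 1) \<inter> P n) <+>\<^bsub>A\<^esub> (Q i \<inter> P (n - 1))"
      unfolding set_add_def' using u by blast
  next
    assume "x \<ominus>\<^bsub>A\<^esub> y \<in> (Q (i - 1) \<inter> P n) <+>\<^bsub>A\<^esub> (Q i \<inter> P (n - 1))"
    then obtain u v where uv: "u \<in> Q (i - 1) \<inter> P n" "v \<in> P (n - 1)" "x \<ominus>\<^bsub>A\<^esub> y = u \<oplus>\<^bsub>A\<^esub> v"
      unfolding set_add_def' by blast
    have "(x \<ominus>\<^bsub>A\<^esub> y) \<ominus>\<^bsub>A\<^esub> u = v"
      unfolding uv(3) using uv(1) by (intro M.add_minus_cancel c[OF uv(2)] c[of u n]) blast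
    with uv(2) have "(x \<ominus>\<^bsub>A\<^esub> y) \<ominus>\<^bsub>A\<^esub> u \<in> P (n - 1)" by simp
    then show "\<exists>u\<in>Q (i - 1) \<inter> P n. (x \<ominus>\<^bsub>A\<^esub> y) \<ominus>\<^bsub>A\<^esub> u \<in> P (n - 1)"
      using uv(1) by (rule bexI)
  qed
  finally show ?thesis .
qed

end

section \<open>Presentations by the bifiltered algebra\<close>

context weight_filtered_algebra
begin

definition bilevel :: "int \<Rightarrow> int \<Rightarrow> 'a set"
  where "bilevel i n = F i \<inter> W n"

text \<open>The common kernel of the maps from \<open>bilevel i n\<close> to the two iterated quotients.\<close>

definition lower_levels :: "int \<Rightarrow> int \<Rightarrow> 'a set"
  where "lower_levels i n = (F (i - 1) \<inter> W n) <+>\<^bsub>A\<^esub> (F i \<inter> W (n - 1))"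

lemma bilevel_submodule: "submodule (bilevel i n) R A"
  unfolding bilevel_def by (rule submodule_Int[OF F_subspace W_subspace])

lemma bilevel_carrier: "x \<in> bilevel i n \<Longrightarrow> x \<in> carrier A"
  using submoduleE(1)[OF bilevel_submodule] by blast

lemma bilevel_add: "\<lbrakk>x \<in> bilevel i n; y \<in> bilevel i n\<rbrakk> \<Longrightarrow> x \<oplus>\<^bsub>A\<^esub> y \<in> bilevel i n"
  using submoduleE(5)[OF bilevel_submodule] by blast

lemma bilevel_neg: "x \<in> bilevel i n \<Longrightarrow> \<ominus>\<^bsub>A\<^esub> x \<in> bilevel i n"
  using submoduleE(3)[OF bilevel_submodule] by blast

lemma bilevel_smult: "\<lbrakk>c \<in> carrier R; x \<in> bilevel i n\<rbrakk> \<Longrightarrow> c \<odot>\<^bsub>A\<^esub> x \<in> bilevel i n"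
  using submoduleE(4)[OF bilevel_submodule] by blast

lemma zero_in_submodule: "submodule H R A \<Longrightarrow> \<zero>\<^bsub>A\<^esub> \<in> H"
  using subgroup.one_closed[OF submodule.axioms(1)] by fastforce

lemma bilevel_mult:
  "\<lbrakk>x \<in> bilevel i n; y \<in> bilevel j m; k = i + j; l = n + m\<rbrakk> \<Longrightarrow> x \<otimes>\<^bsub>A\<^esub> y \<in> bilevel k l"
  by (simp add: bilevel_def F_mult W_mult)

lemma bilevel_d: "\<lbrakk>x \<in> bilevel i n; k = i + 1\<rbrakk> \<Longrightarrow> \<partial>\<^bsub>A\<^esub> x \<in> bilevel k n"
  by (simp add: bilevel_def d_filtered W_d)

lemma koszul_bilevel: "x \<in> bilevel i n \<Longrightarrow> koszul A p x \<in> bilevel i n"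
  by (simp add: koszul_def bilevel_neg)

lemma bilevel_lower:
  assumes x: "x \<in> bilevel (i - 1) n"
  shows "x \<in> lower_levels i n"
proof -
  have "\<zero>\<^bsub>A\<^esub> \<in> F i \<inter> W (n - 1)"
    by (rule zero_in_submodule[OF submodule_Int[OF F_subspace W_subspace]])
  moreover have "x = x \<oplus>\<^bsub>A\<^esub> \<zero>\<^bsub>A\<^esub>" by (rule M.r_zero[OF bilevel_carrier[OF x], symmetric])
  ultimately show ?thesis
    using x unfolding lower_levels_def set_add_def' bilevel_def by blast
qed

text \<open>The axiom speaks of the exact filtration degrees \<open>fdeg F a\<close> and \<open>fdeg F b\<close>, whereas here \<open>i\<close> and \<open>j\<close>
  are only upper bounds for them, and the sign is determined by \<open>i\<close>. If one of the bounds
  is not attained, each of the three terms lies in \<open>F (i + j)\<close> by itself and the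
  sign does not matter. Otherwise the degrees are \<open>i\<close> and \<open>j\<close> and the axiom applies.\<close>

lemma Leibniz_defect_lower:
  assumes a: "a \<in> bilevel i n" and b: "b \<in> bilevel j m"
  shows "\<partial>\<^bsub>A\<^esub> (a \<otimes>\<^bsub>A\<^esub> b) \<ominus>\<^bsub>A\<^esub> (\<partial>\<^bsub>A\<^esub> a \<otimes>\<^bsub>A\<^esub> b \<oplus>\<^bsub>A\<^esub> koszul A i (a \<otimes>\<^bsub>A\<^esub> \<partial>\<^bsub>A\<^esub> b)) \<in> bilevel (i + j) (n + m)"
    (is "?D \<in> _")
proof -
  \<comment> \<open>the case that one of the two bounds is not attained\<close>
  have small: "?D \<in> bilevel (i + j) (n + m)"
    if a': "a \<in> bilevel i' n" and b': "b \<in> bilevel j' m" and ij: "i' + j' = i + j - 1" for i' j'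
    unfolding a_minus_def
  proof (intro bilevel_add bilevel_neg koszul_bilevel)
    show "\<partial>\<^bsub>A\<^esub> (a \<otimes>\<^bsub>A\<^esub> b) \<in> bilevel (i + j) (n + m)"
      using ij by (intro bilevel_d[OF bilevel_mult[OF a' b' refl refl]]) simp
    show "\<partial>\<^bsub>A\<^esub> a \<otimes>\<^bsub>A\<^esub> b \<in> bilevel (i + j) (n + m)"
      using ij by (intro bilevel_mult[OF bilevel_d[OF a' refl] b']) simp_all
    show "a \<otimes>\<^bsub>A\<^esub> \<partial>\<^bsub>A\<^esub> b \<in> bilevel (i + j) (n + m)"
      using ij by (intro bilevel_mult[OF a' bilevel_d[OF b' refl]]) simp_all
  qed
  have W: "?D \<in> W (n + m)"
  proof -
    have "\<partial>\<^bsub>A\<^esub> (a \<otimes>\<^bsub>A\<^esub> b) \<in> bilevel (i + j + 1) (n + m)"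
      by (intro bilevel_d[OF bilevel_mult[OF a b refl refl]]) simp
    moreover have "\<partial>\<^bsub>A\<^esub> a \<otimes>\<^bsub>A\<^esub> b \<in> bilevel (i + j + 1) (n + m)"
      by (intro bilevel_mult[OF bilevel_d[OF a refl] b]) simp_all
    moreover have "a \<otimes>\<^bsub>A\<^esub> \<partial>\<^bsub>A\<^esub> b \<in> bilevel (i + j + 1) (n + m)"
      by (intro bilevel_mult[OF a bilevel_d[OF b refl]]) simp_all
    ultimately have "?D \<in> bilevel (i + j + 1) (n + m)"
      unfolding a_minus_def by (intro bilevel_add bilevel_neg koszul_bilevel)
    then show ?thesis by (simp add: bilevel_def)
  qed
  consider "a \<in> F (i - 1)" | "b \<in> F (j - 1)" | "a \<notin> F (i - 1)" "b \<notin> F (j - 1)" by blast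
  then show ?thesis
  proof cases
    case 1
    then show ?thesis using a b by (intro small[of "i - 1" j]) (auto simp: bilevel_def)
  next
    case 2
    then show ?thesis using a b by (intro small[of i "j - 1"]) (auto simp: bilevel_def)
  next
    case 3
    have F_le: "F k \<subseteq> F l" if "k \<le> l" for k l
      using that
    proof (induction rule: int_ge_induct)
      case (step l)
      show ?case by (rule subset_trans[OF step.IH F_mono])
    qed (rule subset_refl)
    have fdeg: "fdeg F x = k" if "x \<in> F k" "x \<notin> F (k - 1)" for x k
      unfolding fdeg_def
    proof (rule Least_equality)
      show "x \<in> F k" by (rule that(1))
      fix l assume "x \<in> F l"
      then have "\<not> l \<le> k - 1" using F_le[of l "k - 1"] that(2) by blast
      then show "k \<le> l" by simp
    qed
    have "a \<noteq> \<zero>\<^bsub>A\<^esub>" "b \<noteq> \<zero>\<^bsub>A\<^esub>" using 3 zero_in_submodule[OF F_subspace] by auto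
    from Leibniz_filtered[OF bilevel_carrier[OF a] this(1) bilevel_carrier[OF b] this(2)]
    have "?D \<in> F (i + j)"
      using a b fdeg[OF _ 3(1)] fdeg[OF _ 3(2)] by (simp add: bilevel_def)
    with W show ?thesis by (simp add: bilevel_def)
  qed
qed

end

text \<open>The kernel is prescribed here, so the spaces \<open>C i n\<close> with all their operations are
  determined by \<open>A\<close> up to isomorphism.\<close>

locale bigraded_presentation = weight_filtered_algebra R A F W
  for R :: "('k, 'r) ring_scheme" (structure) and A :: "('k, 'a, 'm) dmodule_scheme" (structure)
    and F W :: "int \<Rightarrow> 'a set" +
  fixes C :: "int \<Rightarrow> int \<Rightarrow> ('k, 'b, 'c) dmodule_scheme"
    and \<pi> :: "int \<Rightarrow> int \<Rightarrow> 'a \<Rightarrow> 'b"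
  assumes pi_onto: "carrier (C i n) = \<pi> i n ` bilevel i n"
    and pi_zero: "\<zero>\<^bsub>C i n\<^esub> = \<pi> i n \<zero>\<^bsub>A\<^esub>"
    and pi_add: "\<lbrakk>x \<in> bilevel i n; y \<in> bilevel i n\<rbrakk> \<Longrightarrow>
      \<pi> i n x \<oplus>\<^bsub>C i n\<^esub> \<pi> i n y = \<pi> i n (x \<oplus>\<^bsub>A\<^esub> y)"
    and pi_smult: "\<lbrakk>c \<in> carrier R; x \<in> bilevel i n\<rbrakk> \<Longrightarrow>
      c \<odot>\<^bsub>C i n\<^esub> \<pi> i n x = \<pi> i n (c \<odot>\<^bsub>A\<^esub> x)"
    and pi_mult_sum: "\<lbrakk>x \<in> bilevel i n; y \<in> bilevel j m\<rbrakk> \<Longrightarrow>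
      \<pi> i n x \<otimes>\<^bsub>C (i + j) (n + m)\<^esub> \<pi> j m y = \<pi> (i + j) (n + m) (x \<otimes>\<^bsub>A\<^esub> y)"
    and pi_d_Suc: "x \<in> bilevel i n \<Longrightarrow> \<partial>\<^bsub>C (i + 1) n\<^esub> (\<pi> i n x) = \<pi> (i + 1) n (\<partial>\<^bsub>A\<^esub> x)"
    and pi_eq_iff: "\<lbrakk>x \<in> bilevel i n; y \<in> bilevel i n\<rbrakk> \<Longrightarrow>
      \<pi> i n x = \<pi> i n y \<longleftrightarrow> x \<ominus>\<^bsub>A\<^esub> y \<in> lower_levels i n"
begin

lemma pi_mult: "\<lbrakk>x \<in> bilevel i n; y \<in> bilevel j m; k = i + j; l = n + m\<rbrakk> \<Longrightarrow>
    \<pi> i n x \<otimes>\<^bsub>C k l\<^esub> \<pi> j m y = \<pi> k l (x \<otimes>\<^bsub>A\<^esub> y)"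
  by (hypsubst, rule pi_mult_sum)

lemma pi_d: "\<lbrakk>x \<in> bilevel i n; k = i + 1\<rbrakk> \<Longrightarrow> \<partial>\<^bsub>C k n\<^esub> (\<pi> i n x) = \<pi> k n (\<partial>\<^bsub>A\<^esub> x)"
  by (hypsubst, rule pi_d_Suc)

lemma pi_closed: "x \<in> bilevel i n \<Longrightarrow> \<pi> i n x \<in> carrier (C i n)"
  unfolding pi_onto by (rule imageI)

lemma C_module: "module R (C i n)"
  by (rule module_imageI[OF module_axioms bilevel_submodule pi_onto pi_zero pi_add pi_smult])

lemma pi_neg:
  assumes "x \<in> bilevel i n"
  shows "\<ominus>\<^bsub>C i n\<^esub> \<pi> i n x = \<pi> i n (\<ominus>\<^bsub>A\<^esub> x)"
proof -
  interpret C: module R "C i n" by (rule C_module)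
  have "\<pi> i n (\<ominus>\<^bsub>A\<^esub> x) \<oplus>\<^bsub>C i n\<^esub> \<pi> i n x = \<zero>\<^bsub>C i n\<^esub>"
    unfolding pi_add[OF bilevel_neg[OF assms] assms] pi_zero
    using M.l_neg[OF bilevel_carrier[OF assms]] by simp
  then show ?thesis
    by (intro C.minus_equality pi_closed bilevel_neg assms)
qed

lemma pi_koszul:
  "x \<in> bilevel i n \<Longrightarrow> koszul (C i n) s (\<pi> i n x) = \<pi> i n (koszul A s x)"
  by (simp add: koszul_def pi_neg)

lemma pi_lower:
  assumes "x \<in> bilevel i n" "x \<in> bilevel (i - 1) n"
  shows "\<pi> i n x = \<zero>\<^bsub>C i n\<^esub>"
proof -
  have "x \<ominus>\<^bsub>A\<^esub> \<zero>\<^bsub>A\<^esub> = x" using bilevel_carrier[OF assms(1)] by (simp add: a_minus_def)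
  then show ?thesis
    unfolding pi_zero pi_eq_iff[OF assms(1) zero_in_submodule[OF bilevel_submodule]]
    using bilevel_lower[OF assms(2)] by simp
qed

text \<open>Every axiom is checked on representatives. The identities that hold in \<open>A\<close> carry over
  through \<open>\<pi>\<close>; \<open>\<partial>\<^sup>2 = 0\<close> and the Leibniz rule hold in \<open>A\<close> up to elements of
  \<open>bilevel (k - 1) l\<close>, where \<open>(k, l)\<close> is the bidegree of the identity, and \<open>\<pi> k l\<close> kills these.\<close>

lemma targets_bigraded_dg_pieces: "bigraded_dg_pieces R C"
proof (intro bigraded_dg_pieces.intro field_axioms bigraded_dg_pieces_axioms.intro C_module)
  fix i n k l
  show "linear_map R (C i n) (C k l) (\<lambda>x. x \<otimes>\<^bsub>C k l\<^esub> y)" if y: "y \<in> carrier (C (k - i) (l - n))" for y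
  proof -
    from y obtain v where v: "v \<in> bilevel (k - i) (l - n)" "y = \<pi> (k - i) (l - n) v"
      unfolding pi_onto by blast
    have m: "\<pi> i n u \<otimes>\<^bsub>C k l\<^esub> y = \<pi> k l (u \<otimes>\<^bsub>A\<^esub> v)" "u \<otimes>\<^bsub>A\<^esub> v \<in> bilevel k l"
      if "u \<in> bilevel i n" for u
      unfolding v(2) by (rule pi_mult[OF that v(1)] bilevel_mult[OF that v(1)], simp, simp)+
    note lin = linear_mapD[OF mult_linear_left[OF bilevel_carrier[OF v(1)]]]
    show ?thesis
      unfolding linear_map_def pi_onto
    proof (intro conjI funcsetI ballI; elim imageE; hypsubst)
      fix u assume u: "u \<in> bilevel i n"
      show "\<pi> i n u \<otimes>\<^bsub>C k l\<^esub> y \<in> \<pi> k l ` bilevel k l"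
        unfolding m(1)[OF u] by (rule imageI[OF m(2)[OF u]])
      show "(c \<odot>\<^bsub>C i n\<^esub> \<pi> i n u) \<otimes>\<^bsub>C k l\<^esub> y = c \<odot>\<^bsub>C k l\<^esub> (\<pi> i n u \<otimes>\<^bsub>C k l\<^esub> y)"
        if c: "c \<in> carrier R" for c
        unfolding pi_smult[OF c u] m(1)[OF u] m(1)[OF bilevel_smult[OF c u]] pi_smult[OF c m(2)[OF u]]
          lin(3)[OF c bilevel_carrier[OF u]] ..
      fix u' assume u': "u' \<in> bilevel i n"
      show "(\<pi> i n u \<oplus>\<^bsub>C i n\<^esub> \<pi> i n u') \<otimes>\<^bsub>C k l\<^esub> y
        = \<pi> i n u \<otimes>\<^bsub>C k l\<^esub> y \<oplus>\<^bsub>C k l\<^esub> \<pi> i n u' \<otimes>\<^bsub>C k l\<^esub> y"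
        unfolding pi_add[OF u u'] m(1)[OF u] m(1)[OF u'] m(1)[OF bilevel_add[OF u u']]
          pi_add[OF m(2)[OF u] m(2)[OF u']] lin(2)[OF bilevel_carrier[OF u] bilevel_carrier[OF u']] ..
    qed
  qed
  show "linear_map R (C (k - i) (l - n)) (C k l) (\<lambda>y. x \<otimes>\<^bsub>C k l\<^esub> y)" if x: "x \<in> carrier (C i n)" for x
  proof -
    from x obtain v where v: "v \<in> bilevel i n" "x = \<pi> i n v"
      unfolding pi_onto by blast
    let ?i = "k - i" and ?n = "l - n"
    have m: "x \<otimes>\<^bsub>C k l\<^esub> \<pi> ?i ?n u = \<pi> k l (v \<otimes>\<^bsub>A\<^esub> u)" "v \<otimes>\<^bsub>A\<^esub> u \<in> bilevel k l"
      if "u \<in> bilevel ?i ?n" for u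
      unfolding v(2) by (rule pi_mult[OF v(1) that] bilevel_mult[OF v(1) that], simp, simp)+
    note lin = linear_mapD[OF mult_linear_right[OF bilevel_carrier[OF v(1)]]]
    show ?thesis
      unfolding linear_map_def pi_onto
    proof (intro conjI funcsetI ballI; elim imageE; hypsubst)
      fix u assume u: "u \<in> bilevel ?i ?n"
      show "x \<otimes>\<^bsub>C k l\<^esub> \<pi> ?i ?n u \<in> \<pi> k l ` bilevel k l"
        unfolding m(1)[OF u] by (rule imageI[OF m(2)[OF u]])
      show "x \<otimes>\<^bsub>C k l\<^esub> (c \<odot>\<^bsub>C ?i ?n\<^esub> \<pi> ?i ?n u) = c \<odot>\<^bsub>C k l\<^esub> (x \<otimes>\<^bsub>C k l\<^esub> \<pi> ?i ?n u)"
        if c: "c \<in> carrier R" for c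
        unfolding pi_smult[OF c u] m(1)[OF u] m(1)[OF bilevel_smult[OF c u]] pi_smult[OF c m(2)[OF u]]
          lin(3)[OF c bilevel_carrier[OF u]] ..
      fix u' assume u': "u' \<in> bilevel ?i ?n"
      show "x \<otimes>\<^bsub>C k l\<^esub> (\<pi> ?i ?n u \<oplus>\<^bsub>C ?i ?n\<^esub> \<pi> ?i ?n u')
        = x \<otimes>\<^bsub>C k l\<^esub> \<pi> ?i ?n u \<oplus>\<^bsub>C k l\<^esub> x \<otimes>\<^bsub>C k l\<^esub> \<pi> ?i ?n u'"
        unfolding pi_add[OF u u'] m(1)[OF u] m(1)[OF u'] m(1)[OF bilevel_add[OF u u']]
          pi_add[OF m(2)[OF u] m(2)[OF u']] lin(2)[OF bilevel_carrier[OF u] bilevel_carrier[OF u']] ..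
    qed
  qed
  show "linear_map R (C i n) (C (i + 1) n) \<partial>\<^bsub>C (i + 1) n\<^esub>"
    unfolding linear_map_def pi_onto
  proof (intro conjI funcsetI ballI; elim imageE; hypsubst)
    fix u assume u: "u \<in> bilevel i n"
    note du = bilevel_d[OF u refl] and d = pi_d[OF _ refl]
    show "\<partial>\<^bsub>C (i + 1) n\<^esub> (\<pi> i n u) \<in> \<pi> (i + 1) n ` bilevel (i + 1) n"
      unfolding d[OF u] by (rule imageI[OF du])
    show "\<partial>\<^bsub>C (i + 1) n\<^esub> (c \<odot>\<^bsub>C i n\<^esub> \<pi> i n u) = c \<odot>\<^bsub>C (i + 1) n\<^esub> \<partial>\<^bsub>C (i + 1) n\<^esub> (\<pi> i n u)"
      if c: "c \<in> carrier R" for c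
      unfolding pi_smult[OF c u] d[OF u] d[OF bilevel_smult[OF c u]] pi_smult[OF c du]
        linear_mapD(3)[OF d_linear c bilevel_carrier[OF u]] ..
    fix u' assume u': "u' \<in> bilevel i n"
    show "\<partial>\<^bsub>C (i + 1) n\<^esub> (\<pi> i n u \<oplus>\<^bsub>C i n\<^esub> \<pi> i n u')
      = \<partial>\<^bsub>C (i + 1) n\<^esub> (\<pi> i n u) \<oplus>\<^bsub>C (i + 1) n\<^esub> \<partial>\<^bsub>C (i + 1) n\<^esub> (\<pi> i n u')"
      unfolding pi_add[OF u u'] d[OF u] d[OF u'] d[OF bilevel_add[OF u u']]
        pi_add[OF du bilevel_d[OF u' refl]]
        linear_mapD(2)[OF d_linear bilevel_carrier[OF u] bilevel_carrier[OF u']] ..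
  qed
  show "\<partial>\<^bsub>C (i + 2) n\<^esub> (\<partial>\<^bsub>C (i + 1) n\<^esub> x) = \<zero>\<^bsub>C (i + 2) n\<^esub>" if x: "x \<in> carrier (C i n)" for x
  proof -
    from x obtain u where u: "u \<in> bilevel i n" and x_eq: "x = \<pi> i n u" unfolding pi_onto by blast
    have du: "\<partial>\<^bsub>A\<^esub> u \<in> bilevel (i + 1) n" by (rule bilevel_d[OF u refl])
    have ddu: "\<partial>\<^bsub>A\<^esub> (\<partial>\<^bsub>A\<^esub> u) \<in> bilevel (i + 2) n" by (rule bilevel_d[OF du]) simp
    have e: "i + 2 - 1 = i + 1" by simp
    have "\<partial>\<^bsub>A\<^esub> (\<partial>\<^bsub>A\<^esub> u) \<in> bilevel (i + 2 - 1) n"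
      using u ddu d_square_filtered[of u i] unfolding bilevel_def e by blast
    from pi_lower[OF ddu this] show ?thesis
      unfolding x_eq pi_d[OF u refl] using pi_d[OF du, of "i + 2"] by simp
  qed
  show "\<partial>\<^bsub>C k l\<^esub> (x \<otimes>\<^bsub>C (k - 1) l\<^esub> y) =
      \<partial>\<^bsub>C (i + 1) n\<^esub> x \<otimes>\<^bsub>C k l\<^esub> y \<oplus>\<^bsub>C k l\<^esub> koszul (C k l) i (x \<otimes>\<^bsub>C k l\<^esub> \<partial>\<^bsub>C (k - i) (l - n)\<^esub> y)"
    if x: "x \<in> carrier (C i n)" and y: "y \<in> carrier (C (k - i - 1) (l - n))" for x y
  proof -
    from x obtain u where u: "u \<in> bilevel i n" and x_eq: "x = \<pi> i n u" unfolding pi_onto by blast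
    from y obtain v where v: "v \<in> bilevel (k - i - 1) (l - n)" and y_eq: "y = \<pi> (k - i - 1) (l - n) v"
      unfolding pi_onto by blast
    have du: "\<partial>\<^bsub>A\<^esub> u \<in> bilevel (i + 1) n" by (rule bilevel_d[OF u refl])
    have dv: "\<partial>\<^bsub>A\<^esub> v \<in> bilevel (k - i) (l - n)" by (rule bilevel_d[OF v]) simp
    have uv: "u \<otimes>\<^bsub>A\<^esub> v \<in> bilevel (k - 1) l" by (rule bilevel_mult[OF u v]) simp_all
    have duv: "\<partial>\<^bsub>A\<^esub> (u \<otimes>\<^bsub>A\<^esub> v) \<in> bilevel k l" by (rule bilevel_d[OF uv]) simp
    have a: "\<partial>\<^bsub>A\<^esub> u \<otimes>\<^bsub>A\<^esub> v \<in> bilevel k l" by (rule bilevel_mult[OF du v]) simp_all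
    have b: "u \<otimes>\<^bsub>A\<^esub> \<partial>\<^bsub>A\<^esub> v \<in> bilevel k l" by (rule bilevel_mult[OF u dv]) simp_all
    note ab = bilevel_add[OF a koszul_bilevel[OF b]]
    have "\<pi> k l (\<partial>\<^bsub>A\<^esub> (u \<otimes>\<^bsub>A\<^esub> v)) = \<pi> k l (\<partial>\<^bsub>A\<^esub> u \<otimes>\<^bsub>A\<^esub> v \<oplus>\<^bsub>A\<^esub> koszul A i (u \<otimes>\<^bsub>A\<^esub> \<partial>\<^bsub>A\<^esub> v))"
      unfolding pi_eq_iff[OF duv ab]
      using Leibniz_defect_lower[OF u v] by (intro bilevel_lower) simp
    moreover have "x \<otimes>\<^bsub>C (k - 1) l\<^esub> y = \<pi> (k - 1) l (u \<otimes>\<^bsub>A\<^esub> v)"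
      unfolding x_eq y_eq by (rule pi_mult[OF u v]) simp_all
    moreover have "\<partial>\<^bsub>C k l\<^esub> (\<pi> (k - 1) l (u \<otimes>\<^bsub>A\<^esub> v)) = \<pi> k l (\<partial>\<^bsub>A\<^esub> (u \<otimes>\<^bsub>A\<^esub> v))"
      by (rule pi_d[OF uv]) simp
    moreover have "\<partial>\<^bsub>C (i + 1) n\<^esub> x \<otimes>\<^bsub>C k l\<^esub> y = \<pi> k l (\<partial>\<^bsub>A\<^esub> u \<otimes>\<^bsub>A\<^esub> v)"
      unfolding x_eq y_eq pi_d[OF u refl] by (rule pi_mult[OF du v]) simp_all
    moreover have "\<partial>\<^bsub>C (k - i) (l - n)\<^esub> y = \<pi> (k - i) (l - n) (\<partial>\<^bsub>A\<^esub> v)"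
      unfolding y_eq by (rule pi_d[OF v]) simp
    moreover have "x \<otimes>\<^bsub>C k l\<^esub> \<pi> (k - i) (l - n) (\<partial>\<^bsub>A\<^esub> v) = \<pi> k l (u \<otimes>\<^bsub>A\<^esub> \<partial>\<^bsub>A\<^esub> v)"
      unfolding x_eq by (rule pi_mult[OF u dv]) simp_all
    ultimately show ?thesis
      by (simp only: pi_koszul[OF b] pi_add[OF a koszul_bilevel[OF b]])
  qed
  fix j m
  show "(x \<otimes>\<^bsub>C (i + j) (n + m)\<^esub> y) \<otimes>\<^bsub>C k l\<^esub> z = x \<otimes>\<^bsub>C k l\<^esub> (y \<otimes>\<^bsub>C (k - i) (l - n)\<^esub> z)"
    if x: "x \<in> carrier (C i n)" and y: "y \<in> carrier (C j m)"
      and z: "z \<in> carrier (C (k - i - j) (l - n - m))" for x y z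
  proof -
    from x obtain u where u: "u \<in> bilevel i n" and x_eq: "x = \<pi> i n u" unfolding pi_onto by blast
    from y obtain v where v: "v \<in> bilevel j m" and y_eq: "y = \<pi> j m v" unfolding pi_onto by blast
    from z obtain w where w: "w \<in> bilevel (k - i - j) (l - n - m)"
      and z_eq: "z = \<pi> (k - i - j) (l - n - m) w"
      unfolding pi_onto by blast
    have "y \<otimes>\<^bsub>C (k - i) (l - n)\<^esub> z = \<pi> (k - i) (l - n) (v \<otimes>\<^bsub>A\<^esub> w)"
      unfolding y_eq z_eq by (rule pi_mult[OF v w]) simp_all
    moreover have vw: "v \<otimes>\<^bsub>A\<^esub> w \<in> bilevel (k - i) (l - n)" by (rule bilevel_mult[OF v w]) simp_all
    have "x \<otimes>\<^bsub>C k l\<^esub> \<pi> (k - i) (l - n) (v \<otimes>\<^bsub>A\<^esub> w) = \<pi> k l (u \<otimes>\<^bsub>A\<^esub> (v \<otimes>\<^bsub>A\<^esub> w))"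
      unfolding x_eq by (rule pi_mult[OF u vw]) simp_all
    moreover have "x \<otimes>\<^bsub>C (i + j) (n + m)\<^esub> y = \<pi> (i + j) (n + m) (u \<otimes>\<^bsub>A\<^esub> v)"
      unfolding x_eq y_eq by (rule pi_mult[OF u v]) simp_all
    moreover have "\<pi> (i + j) (n + m) (u \<otimes>\<^bsub>A\<^esub> v) \<otimes>\<^bsub>C k l\<^esub> z = \<pi> k l ((u \<otimes>\<^bsub>A\<^esub> v) \<otimes>\<^bsub>A\<^esub> w)"
      unfolding z_eq by (rule pi_mult[OF bilevel_mult[OF u v refl refl] w]) simp_all
    ultimately show ?thesis
      by (simp only: mult_assoc[OF bilevel_carrier[OF u] bilevel_carrier[OF v] bilevel_carrier[OF w]])
  qed
qed

end

text \<open>The isomorphism sends \<open>\<pi> x\<close> to \<open>\<rho> x\<close>. It is well defined and injective because \<open>\<pi>\<close> and \<open>\<rho>\<close> have the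
  same kernels.\<close>

theorem bigraded_presentation_unique:
  assumes "bigraded_presentation R A F W C \<pi>" and "bigraded_presentation R A F W D \<rho>"
  shows "\<exists>\<phi>. weight_graded_dg_iso R (bigraded_sum C) (bigraded_sum D) \<phi>"
proof -
  interpret C: bigraded_presentation R A F W C \<pi> by (rule assms(1))
  interpret D: bigraded_presentation R A F W D \<rho> by (rule assms(2))
  define \<phi> where "\<phi> i n c = \<rho> i n (inv_into (C.bilevel i n) (\<pi> i n) c)" for i n c
  have phi: "\<phi> i n (\<pi> i n x) = \<rho> i n x" if x: "x \<in> C.bilevel i n" for i n x
  proof -
    let ?y = "inv_into (C.bilevel i n) (\<pi> i n) (\<pi> i n x)"
    have y: "?y \<in> C.bilevel i n" by (rule inv_into_into[OF imageI[OF x]])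
    have "\<pi> i n ?y = \<pi> i n x" by (rule f_inv_into_f[OF imageI[OF x]])
    then show ?thesis unfolding \<phi>_def C.pi_eq_iff[OF y x] D.pi_eq_iff[OF y x] .
  qed
  have "weight_graded_dg_iso R (bigraded_sum C) (bigraded_sum D) (\<lambda>f i n. \<phi> i n (f i n))"
  proof (rule bigraded_sum_isoI[OF C.targets_bigraded_dg_pieces D.targets_bigraded_dg_pieces])
    fix i n
    show "bij_betw (\<phi> i n) (carrier (C i n)) (carrier (D i n))"
      unfolding bij_betw_def
    proof
      show "inj_on (\<phi> i n) (carrier (C i n))"
        unfolding C.pi_onto
      proof (rule inj_onI; elim imageE; hypsubst)
        fix x y assume "x \<in> C.bilevel i n" "y \<in> C.bilevel i n" "\<phi> i n (\<pi> i n x) = \<phi> i n (\<pi> i n y)"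
        then show "\<pi> i n x = \<pi> i n y" by (simp only: phi C.pi_eq_iff D.pi_eq_iff)
      qed
      show "\<phi> i n ` carrier (C i n) = carrier (D i n)"
        unfolding C.pi_onto D.pi_onto image_image by (rule image_cong[OF refl phi])
    qed
    show "linear_map R (C i n) (D i n) (\<phi> i n)"
      unfolding linear_map_def C.pi_onto D.pi_onto
    proof (intro conjI funcsetI ballI; elim imageE; hypsubst)
      fix u assume u: "u \<in> C.bilevel i n"
      show "\<phi> i n (\<pi> i n u) \<in> \<rho> i n ` C.bilevel i n"
        unfolding phi[OF u] by (rule imageI[OF u])
      show "\<phi> i n (c \<odot>\<^bsub>C i n\<^esub> \<pi> i n u) = c \<odot>\<^bsub>D i n\<^esub> \<phi> i n (\<pi> i n u)" if c: "c \<in> carrier R" for c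
        unfolding phi[OF u] C.pi_smult[OF c u] D.pi_smult[OF c u] phi[OF C.bilevel_smult[OF c u]] ..
      fix u' assume u': "u' \<in> C.bilevel i n"
      show "\<phi> i n (\<pi> i n u \<oplus>\<^bsub>C i n\<^esub> \<pi> i n u') = \<phi> i n (\<pi> i n u) \<oplus>\<^bsub>D i n\<^esub> \<phi> i n (\<pi> i n u')"
        unfolding phi[OF u] phi[OF u'] C.pi_add[OF u u'] D.pi_add[OF u u']
          phi[OF C.bilevel_add[OF u u']] ..
    qed
    fix x assume "x \<in> carrier (C i n)"
    then obtain u where u: "u \<in> C.bilevel i n" and x_eq: "x = \<pi> i n u" unfolding C.pi_onto by blast
    show "\<phi> (i + 1) n (\<partial>\<^bsub>C (i + 1) n\<^esub> x) = \<partial>\<^bsub>D (i + 1) n\<^esub> (\<phi> i n x)"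
      unfolding x_eq phi[OF u] C.pi_d[OF u refl] D.pi_d[OF u refl] phi[OF C.bilevel_d[OF u refl]] ..
    fix k l y assume "y \<in> carrier (C (k - i) (l - n))"
    then obtain v where v: "v \<in> C.bilevel (k - i) (l - n)" and y_eq: "y = \<pi> (k - i) (l - n) v"
      unfolding C.pi_onto by blast
    have kl: "k = i + (k - i)" "l = n + (l - n)" by simp_all
    show "\<phi> k l (x \<otimes>\<^bsub>C k l\<^esub> y) = \<phi> i n x \<otimes>\<^bsub>D k l\<^esub> \<phi> (k - i) (l - n) y"
      unfolding x_eq y_eq phi[OF u] phi[OF v] C.pi_mult[OF u v kl] D.pi_mult[OF u v kl]
        phi[OF C.bilevel_mult[OF u v kl]] ..
  qed
  then show ?thesis by (rule exI[of _ "\<lambda>f i n. \<phi> i n (f i n)"])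
qed

section \<open>The two iterated associated graded algebras\<close>

context weight_filtered_algebra
begin

lemma two_filtrations_W_F: "two_filtrations R A W F 0 1"
  by (intro two_filtrations.intro assoc_algebra_axioms two_filtrations_axioms.intro
      W_subspace F_subspace W_mono F_mono W_mult F_mult d_linear d_filtered) (simp_all add: W_d)

lemma two_filtrations_F_W: "two_filtrations R A F W 1 0"
  by (intro two_filtrations.intro assoc_algebra_axioms two_filtrations_axioms.intro
      W_subspace F_subspace W_mono F_mono W_mult F_mult d_linear d_filtered) (simp_all add: W_d)

lemma presentation_gr_F_gr_W:
  "bigraded_presentation R A F W (\<lambda>i n. gr_part (gr_part A W n) (gr_filtration A W F n) i)
     (\<lambda>i n. two_filtrations.gr_gr_class A W F n i)"
proof -
  interpret WF: two_filtrations R A W F 0 1 by (rule two_filtrations_W_F)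
  show ?thesis
  proof (intro bigraded_presentation.intro weight_filtered_algebra_axioms
      bigraded_presentation_axioms.intro; (unfold bilevel_def lower_levels_def)?)
    show "\<partial>\<^bsub>gr_part (gr_part A W n) (gr_filtration A W F n) (i + 1)\<^esub> (WF.gr_gr_class n i x)
      = WF.gr_gr_class n (i + 1) (\<partial>\<^bsub>A\<^esub> x)" if "x \<in> F i \<inter> W n" for x i n
      using WF.gr_gr_d[of x i n] that by simp
  qed (simp_all add: WF.gr_gr_carrier WF.gr_gr_zero WF.gr_gr_add WF.gr_gr_smult WF.gr_gr_mult
      WF.gr_gr_class_eq_iff)
qed

text \<open>Here \<open>F\<close> comes first, so the kernel found in \<open>two_filtrations\<close> has its two summands,
  and the factors of each intersection, in the opposite order.\<close>

lemma presentation_gr_W_gr_F: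
  "bigraded_presentation R A F W (\<lambda>i n. gr_part (gr_part A F i) (gr_filtration A F W i) n)
     (\<lambda>i n. two_filtrations.gr_gr_class A F W i n)"
proof -
  interpret FW: two_filtrations R A F W 1 0 by (rule two_filtrations_F_W)
  have lower: "lower_levels i n = (W (n - 1) \<inter> F i) <+>\<^bsub>A\<^esub> (W n \<inter> F (i - 1))" for i n
    unfolding lower_levels_def Int_commute[of "W _"]
    by (intro M.set_add_commute submoduleE(1) submodule_Int F_subspace W_subspace)
  show ?thesis
  proof (intro bigraded_presentation.intro weight_filtered_algebra_axioms
      bigraded_presentation_axioms.intro; (unfold bilevel_def lower)?)
    show "\<partial>\<^bsub>gr_part (gr_part A F (i + 1)) (gr_filtration A F W (i + 1)) n\<^esub> (FW.gr_gr_class i n x)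
      = FW.gr_gr_class (i + 1) n (\<partial>\<^bsub>A\<^esub> x)" if "x \<in> F i \<inter> W n" for x i n
      using FW.gr_gr_d[of x n i] that by simp
    show "carrier (gr_part (gr_part A F i) (gr_filtration A F W i) n)
      = FW.gr_gr_class i n ` (F i \<inter> W n)" for i n
      unfolding FW.gr_gr_carrier Int_commute[of "W n"] ..
  qed (simp_all add: FW.gr_gr_zero FW.gr_gr_add FW.gr_gr_smult FW.gr_gr_mult
      FW.gr_gr_class_eq_iff)
qed

end

theorem lemma2p8:
  fixes R :: "('k, 'r) ring_scheme"
    and A :: "('k, 'a, 'm) dmodule_scheme"
    and F W :: "int \<Rightarrow> 'a set"
  assumes "weight_filtered_algebra R A F W"
  shows "weight_graded_dg_algebra R (gr_F_gr_W A F W) \<and>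
         weight_graded_dg_algebra R (gr_W_gr_F A F W) \<and>
         (\<exists>\<phi>. weight_graded_dg_iso R (gr_F_gr_W A F W) (gr_W_gr_F A F W) \<phi>)"
proof -
  interpret weight_filtered_algebra R A F W by (rule assms)
  note FW = presentation_gr_F_gr_W and WF = presentation_gr_W_gr_F
  show ?thesis
    unfolding gr_F_gr_W_def gr_W_gr_F_def
    using bigraded_dg_pieces.bigraded_sum_weight_graded_dg_algebra[OF bigraded_presentation.targets_bigraded_dg_pieces[OF FW]]
      bigraded_dg_pieces.bigraded_sum_weight_graded_dg_algebra[OF bigraded_presentation.targets_bigraded_dg_pieces[OF WF]]
      bigraded_presentation_unique[OF FW WF]
    by blast
qed

end
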